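(* Let $\Pi=(P,\mathcal{L})$ and $\Pi'=(P',\mathcal{L}')$ be $n$-dimensional projective spaces and let $k$ be an integer with $0<k<n-1$. Let $f$ be a mapping of $\mathcal{G}_{k}(\Pi)$ to $\mathcal{G}_{k}(\Pi')$ which sends every base subset of $\mathcal{G}_{k}(\Pi)$ to a base subset of $\mathcal{G}_{k}(\Pi')$. Then: (1) if $n\ne 2k+1$, there is a strong embedding $g$ of $\Pi$ to $\Pi'$ with $f=G_{k}(g)$; (2) if $n=2k+1$, there is a strong embedding $g$ of $\Pi$ to $\Pi'$ or of $\Pi$ to the dual space $\Pi'^{*}$ with $f=G_{k}(g)$ (in the dual case, $G_k(g)$ is regarded as a map to $\mathcal{G}_k(\Pi')$ via the identification $\mathcal{G}_{k}(\Pi'^{*})=\mathcal{G}_{n-k-1}(\Pi')=\mathcal{G}_k(\Pi')$).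
   Context: A linear space $\Pi=(P,\mathcal{L})$ is a set $P$ of points with a family $\mathcal{L}$ of proper subsets (lines) such that each line has at least two points and any two distinct points $p,q$ lie on exactly one line $pq$. Points are collinear if some line contains them. A subspace is a set $S\subset P$ with $pq\subset S$ for all distinct $p,q\in S$; $\overline{X}$ denotes the smallest subspace containing $X$. A set $X$ is independent if $\overline{X}$ is not spanned by a proper subset of $X$; a base of a subspace $S$ is an independent set spanning $S$. A subspace is $m$-dimensional if $m+1$ is the smallest number of points spanning it (the empty set is $(-1)$-dimensional). A projective space is a linear space in which every $2$-dimensional subspace is a projective plane: any two of its lines meet and every line has at least three points. $\mathcal{G}_k(\Pi)$ is the set of $k$-dimensional subspaces. If $B$ is a base of $\Pi$, the base subset of $\mathcal{G}_k(\Pi)$ associated with $B$ is the set of all $k$-dimensional subspaces spanned by points of $B$. A strong embedding of $\Pi$ to $\Pi'$ is an injection $g:P\to P'$ sending collinear triples to collinear triples, non-collinear triples to non-collinear triples, and independent sets to independent sets; then $\dim\overline{g(S)}=\dim S$ for every subspace $S$, and $G_k(g):\mathcal{G}_k(\Pi)\to\mathcal{G}_k(\Pi')$ is $S\mapsto\overline{g(S)}$. The dual $\Pi'^{*}$ of an $n$-dimensional projective space $\Pi'$ has as points the $(n-1)$-dimensional subspaces of $\Pi'$, and as lines the sets of all $(n-1)$-dimensional subspaces containing a fixed $(n-2)$-dimensional subspace; it is an $n$-dimensional projective space whose $k$-dimensional subspaces are the sets of all $(n-1)$-dimensional subspaces of $\Pi'$ containing a fixed $(n-k-1)$-dimensional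 subspace, and $\mathcal{G}_k(\Pi'^{*})$ is identified with $\mathcal{G}_{n-k-1}(\Pi')$ in this way. *)

theory Defs
  imports Main
begin

definition linear_space :: "'a set \<Rightarrow> 'a set set \<Rightarrow> bool" where
  "linear_space P L \<longleftrightarrow>
     (\<forall>l\<in>L. l \<subset> P \<and> (\<exists>p q. p \<noteq> q \<and> p \<in> l \<and> q \<in> l)) \<and>
     (\<forall>p\<in>P. \<forall>q\<in>P. p \<noteq> q \<longrightarrow> (\<exists>!l. l \<in> L \<and> p \<in> l \<and> q \<in> l))"

definition collinear :: "'a set set \<Rightarrow> 'a set \<Rightarrow> bool" where
  "collinear L X \<longleftrightarrow> (\<exists>l\<in>L. X \<subseteq> l)"

definition subspace :: "'a set \<Rightarrow> 'a set set \<Rightarrow> 'a set \<Rightarrow> bool" where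
  "subspace P L S \<longleftrightarrow> S \<subseteq> P \<and>
     (\<forall>l\<in>L. \<forall>p q. p \<in> S \<longrightarrow> q \<in> S \<longrightarrow> p \<noteq> q \<longrightarrow> p \<in> l \<longrightarrow> q \<in> l \<longrightarrow> l \<subseteq> S)"

definition span :: "'a set \<Rightarrow> 'a set set \<Rightarrow> 'a set \<Rightarrow> 'a set" where
  "span P L X = \<Inter>{S. subspace P L S \<and> X \<subseteq> S}"

definition independent :: "'a set \<Rightarrow> 'a set set \<Rightarrow> 'a set \<Rightarrow> bool" where
  "independent P L X \<longleftrightarrow> X \<subseteq> P \<and> (\<forall>Y. Y \<subset> X \<longrightarrow> span P L Y \<noteq> span P L X)"

definition is_base :: "'a set \<Rightarrow> 'a set set \<Rightarrow> 'a set \<Rightarrow> bool" where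
  "is_base P L B \<longleftrightarrow> independent P L B \<and> span P L B = P"

definition has_dim :: "'a set \<Rightarrow> 'a set set \<Rightarrow> 'a set \<Rightarrow> nat \<Rightarrow> bool" where
  "has_dim P L S m \<longleftrightarrow> subspace P L S \<and>
     (\<exists>X. X \<subseteq> P \<and> finite X \<and> card X = Suc m \<and> span P L X = S) \<and>
     (\<forall>X. X \<subseteq> P \<longrightarrow> finite X \<longrightarrow> span P L X = S \<longrightarrow> Suc m \<le> card X)"

definition Gr :: "'a set \<Rightarrow> 'a set set \<Rightarrow> nat \<Rightarrow> 'a set set" where
  "Gr P L k = {S. has_dim P L S k}"

definition projective_space :: "'a set \<Rightarrow> 'a set set \<Rightarrow> bool" where
  "projective_space P L \<longleftrightarrow> linear_space P L \<and>
     (\<forall>S. has_dim P L S 2 \<longrightarrow>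
        (\<forall>l\<in>L. \<forall>m\<in>L. l \<subseteq> S \<longrightarrow> m \<subseteq> S \<longrightarrow> l \<inter> m \<noteq> {}) \<and>
        (\<forall>l\<in>L. l \<subseteq> S \<longrightarrow> (\<exists>a b c. a \<in> l \<and> b \<in> l \<and> c \<in> l \<and> a \<noteq> b \<and> a \<noteq> c \<and> b \<noteq> c)))"

definition proj_space_dim :: "'a set \<Rightarrow> 'a set set \<Rightarrow> nat \<Rightarrow> bool" where
  "proj_space_dim P L n \<longleftrightarrow> projective_space P L \<and> has_dim P L P n"

definition base_subset_of :: "'a set \<Rightarrow> 'a set set \<Rightarrow> nat \<Rightarrow> 'a set \<Rightarrow> 'a set set" where
  "base_subset_of P L k B = {S \<in> Gr P L k. \<exists>X. X \<subseteq> B \<and> span P L X = S}"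

definition is_base_subset :: "'a set \<Rightarrow> 'a set set \<Rightarrow> nat \<Rightarrow> 'a set set \<Rightarrow> bool" where
  "is_base_subset P L k \<B> \<longleftrightarrow> (\<exists>B. is_base P L B \<and> \<B> = base_subset_of P L k B)"

definition strong_embedding ::
  "'a set \<Rightarrow> 'a set set \<Rightarrow> 'b set \<Rightarrow> 'b set set \<Rightarrow> ('a \<Rightarrow> 'b) \<Rightarrow> bool" where
  "strong_embedding P L P' L' g \<longleftrightarrow> inj_on g P \<and> g ` P \<subseteq> P' \<and>
     (\<forall>x\<in>P. \<forall>y\<in>P. \<forall>z\<in>P. collinear L {x, y, z} \<longrightarrow> collinear L' {g x, g y, g z}) \<and>
     (\<forall>x\<in>P. \<forall>y\<in>P. \<forall>z\<in>P. \<not> collinear L {x, y, z} \<longrightarrow> \<not> collinear L' {g x, g y, g z}) \<and>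
     (\<forall>X. X \<subseteq> P \<longrightarrow> independent P L X \<longrightarrow> independent P' L' (g ` X))"

definition dual_points :: "'a set \<Rightarrow> 'a set set \<Rightarrow> nat \<Rightarrow> 'a set set" where
  "dual_points P L n = Gr P L (n - 1)"

definition dual_lines :: "'a set \<Rightarrow> 'a set set \<Rightarrow> nat \<Rightarrow> 'a set set set" where
  "dual_lines P L n = {{H \<in> Gr P L (n - 1). T \<subseteq> H} | T. T \<in> Gr P L (n - 2)}"

end

theory Submission
  imports Defs "HOL.Hull" "HOL-Library.Ramsey"
begin

text \<open>
  Fix a base \<open>B\<close> of \<open>\<Pi>\<close> and write \<open>f\<close> on its base subset as a bijection \<open>\<sigma>\<close> between the
  \<open>(k+1)\<close>-subsets of \<open>B\<close> and of some base \<open>B'\<close> of \<open>\<Pi>'\<close>. Maximal intersections of two distinct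
  base subsets are complements of the sets \<open>C i j = {X. i \<in> X \<and> j \<notin> X}\<close>, so \<open>\<sigma>\<close> maps these sets to
  sets of the same form. Since \<open>C i j\<close> and \<open>C p q\<close> are disjoint exactly if \<open>i = q\<close> or \<open>j = p\<close>, the
  resulting map of ordered pairs comes from a bijection \<open>\<tau> : B \<rightarrow> B'\<close>, possibly after reversing
  all pairs. Hence \<open>\<sigma> X = \<tau> X\<close> for all \<open>X\<close>, or \<open>\<sigma> X = B' - \<tau> X\<close> for all \<open>X\<close>, the latter only if
  \<open>n = 2k + 1\<close>. Any two bases are connected by exchanging one point at a time, and two bases that
  differ in one point share enough \<open>(k+1)\<close>-subsets to see that the alternative does not depend on
  \<open>B\<close> and that \<open>\<tau> p\<close> does not depend on the base containing \<open>p\<close>. In the first case \<open>p \<mapsto> \<tau> p\<close> is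
  the embedding; in the second case, composing \<open>f\<close> with \<open>S \<mapsto> {H. S \<subseteq> H}\<close> gives a map into the
  dual space to which the first case applies.
\<close>

section \<open>Bijections between the subsets of a fixed size\<close>

lemma mem_nsets_iff: "finite A \<Longrightarrow> X \<in> [A]\<^bsup>m\<^esup> \<longleftrightarrow> X \<subseteq> A \<and> card X = m"
  unfolding nsets_def using finite_subset by blast

lemma nset_between:
  assumes "finite B" "Y \<subseteq> B" "Z \<subseteq> B" "Y \<inter> Z = {}" "card Y \<le> m" "m + card Z \<le> card B"
  obtains X where "X \<in> [B]\<^bsup>m\<^esup>" "Y \<subseteq> X" "X \<inter> Z = {}"
proof -
  have "card (B - Z) = card B - card Z" using assms(1,3) by (meson card_Diff_subset finite_subset)
  then have "m \<le> card (B - Z)" using assms(6) by linarith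
  then obtain X where "Y \<subseteq> X" "X \<subseteq> B - Z" "card X = m"
    using exists_subset_between[of Y m "B - Z"] assms by blast
  then show ?thesis using that[of X] assms(1) by (auto simp: mem_nsets_iff)
qed

lemma Inter_nsets_containing:
  assumes "finite A" "Z \<subseteq> A" "card Z \<le> m" "m < card A"
  shows "\<Inter>{X \<in> [A]\<^bsup>m\<^esup>. Z \<subseteq> X} = Z"
proof
  show "\<Inter>{X \<in> [A]\<^bsup>m\<^esup>. Z \<subseteq> X} \<subseteq> Z"
  proof (rule subsetI, rule ccontr)
    fix q assume q: "q \<in> \<Inter>{X \<in> [A]\<^bsup>m\<^esup>. Z \<subseteq> X}" "q \<notin> Z"
    obtain X0 where "X0 \<in> [A]\<^bsup>m\<^esup>" "Z \<subseteq> X0" using nset_between[of A Z "{}" m] assms by auto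
    then have "q \<in> A" using q(1) unfolding nsets_def by blast
    then obtain X where "X \<in> [A]\<^bsup>m\<^esup>" "Z \<subseteq> X" "X \<inter> {q} = {}"
      using nset_between[of A Z "{q}" m] assms q(2) by auto
    then show False using q(1) by blast
  qed
qed blast

definition separating :: "'a set \<Rightarrow> nat \<Rightarrow> 'a \<Rightarrow> 'a \<Rightarrow> 'a set set" where
  "separating B m i j = {X \<in> [B]\<^bsup>m\<^esup>. i \<in> X \<and> j \<notin> X}"

lemma separating_subset_nsets: "separating B m i j \<subseteq> [B]\<^bsup>m\<^esup>"
  unfolding separating_def by blast

lemma card_separating:
  assumes "finite B" "i \<in> B" "j \<in> B" "i \<noteq> j" "0 < m"
  shows "card (separating B m i j) = (card B - 2) choose (m - 1)"
proof -
  let ?C = "B - {i, j}"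
  have C: "finite ?C" "i \<notin> ?C" "card ?C = card B - 2"
    using assms by (simp_all add: card_Diff_subset)
  have "separating B m i j = insert i ` [?C]\<^bsup>(m - 1)\<^esup>"
  proof
    show "separating B m i j \<subseteq> insert i ` [?C]\<^bsup>(m - 1)\<^esup>"
    proof
      fix X assume "X \<in> separating B m i j"
      then have "X - {i} \<in> [?C]\<^bsup>(m - 1)\<^esup>" "X = insert i (X - {i})"
        unfolding separating_def nsets_def by auto
      then show "X \<in> insert i ` [?C]\<^bsup>(m - 1)\<^esup>" by blast
    qed
    show "insert i ` [?C]\<^bsup>(m - 1)\<^esup> \<subseteq> separating B m i j"
      unfolding separating_def nsets_def using assms(2,4,5) by (auto simp: card_insert_if)
  qed
  moreover have "inj_on (insert i) ([?C]\<^bsup>(m - 1)\<^esup>)"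
    unfolding nsets_def using C(2) by (intro inj_onI) blast
  ultimately show ?thesis by (simp add: card_image C(3))
qed

lemma separating_disjoint_iff:
  assumes "finite B" "2 \<le> m" "m + 2 \<le> card B"
    and "i \<in> B" "j \<in> B" "i \<noteq> j" "k \<in> B" "l \<in> B" "k \<noteq> l"
  shows "separating B m i j \<inter> separating B m k l = {} \<longleftrightarrow> i = l \<or> j = k"
proof
  show "separating B m i j \<inter> separating B m k l = {}" if "i = l \<or> j = k"
    using that unfolding separating_def by blast
  show "i = l \<or> j = k" if disjoint: "separating B m i j \<inter> separating B m k l = {}"
  proof (rule ccontr)
    assume "\<not> (i = l \<or> j = k)"
    then have "{i, k} \<inter> {j, l} = {}" using assms(6,9) by blast
    moreover have "card {i, k} \<le> m" "m + card {j, l} \<le> card B"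
      using assms(2,3) by (auto simp: card_insert_if)
    ultimately obtain X where "X \<in> [B]\<^bsup>m\<^esup>" "{i, k} \<subseteq> X" "X \<inter> {j, l} = {}"
      using nset_between[of B "{i, k}" "{j, l}" m] assms by auto
    then show False using disjoint unfolding separating_def by blast
  qed
qed

text \<open>Think of \<open>s i j\<close> and \<open>t i j\<close> as the two points separated by the image of
  \<^term>\<open>separating B m i j\<close>; then \<open>head_to_tail\<close> says that two images are disjoint exactly if
  the original sets are.\<close>

locale head_to_tail_map =
  fixes B :: "'a set" and s t :: "'a \<Rightarrow> 'a \<Rightarrow> 'b"
  assumes four_le_card: "4 \<le> card B"
    and s_neq_t: "\<lbrakk>i \<in> B; j \<in> B; i \<noteq> j\<rbrakk> \<Longrightarrow> s i j \<noteq> t i j"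
    and head_to_tail: "\<lbrakk>i \<in> B; j \<in> B; i \<noteq> j; k \<in> B; l \<in> B; k \<noteq> l\<rbrakk> \<Longrightarrow>
       s i j = t k l \<or> t i j = s k l \<longleftrightarrow> i = l \<or> j = k"
begin

lemma swap: "head_to_tail_map B t s"
  using four_le_card s_neq_t[symmetric] head_to_tail by unfold_locales (metis, metis, metis)

lemma pair_eqD:
  assumes "i \<in> B" "j \<in> B" "i \<noteq> j" "k \<in> B" "l \<in> B" "k \<noteq> l" "s i j = s k l" "t i j = t k l"
  shows "i = k" "j = l"
  using assms head_to_tail[of k i i j] head_to_tail[of k i k l] head_to_tail[of j l i j]
    head_to_tail[of j l k l] by metis+

lemma three_others:
  assumes "i \<in> B"
  obtains a b c where "a \<in> B" "b \<in> B" "c \<in> B" "a \<noteq> i" "b \<noteq> i" "c \<noteq> i" "a \<noteq> b" "a \<noteq> c" "b \<noteq> c"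
proof -
  have "3 \<le> card (B - {i})" using four_le_card assms by simp
  then obtain T where "T \<subseteq> B - {i}" "card T = 3" by (meson obtain_subset_with_card_n)
  then show ?thesis using that by (auto simp: card_3_iff)
qed

text \<open>Pairs with the same source have at least three common neighbours for the head-to-tail
  relation; images with neither a common source nor a common target would have only two.\<close>

lemma same_source_image:
  assumes "i \<in> B" "j \<in> B" "l \<in> B" "i \<noteq> j" "i \<noteq> l" "j \<noteq> l"
  shows "s i j = s i l \<or> t i j = t i l"
proof (rule ccontr)
  assume neq: "\<not> (s i j = s i l \<or> t i j = t i l)"
  have neighbour_image: "(s x i = t i l \<and> t x i = s i j) \<or> (s x i = t i j \<and> t x i = s i l)"
    if "x \<in> B" "x \<noteq> i" for x
    using head_to_tail[of i j x i] head_to_tail[of i l x i] assms that neq by auto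
  obtain a b c where abc: "a \<in> B" "b \<in> B" "c \<in> B" "a \<noteq> i" "b \<noteq> i" "c \<noteq> i" "a \<noteq> b" "a \<noteq> c" "b \<noteq> c"
    using three_others[OF assms(1)] .
  show False
    using neighbour_image[of a] neighbour_image[of b] neighbour_image[of c]
      pair_eqD[of a i b i] pair_eqD[of a i c i] pair_eqD[of b i c i] abc assms(1) by metis
qed

definition preserves_at :: "'a \<Rightarrow> 'b \<Rightarrow> bool" where
  "preserves_at i p \<longleftrightarrow> (\<forall>j\<in>B - {i}. s i j = p \<and> t j i = p)"

definition reverses_at :: "'a \<Rightarrow> 'b \<Rightarrow> bool" where
  "reverses_at i p \<longleftrightarrow> (\<forall>j\<in>B - {i}. t i j = p \<and> s j i = p)"

lemma preserves_at_if_same_source: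
  assumes ab: "a \<in> B" "b \<in> B" "a \<noteq> i" "b \<noteq> i" "a \<noteq> b" and i: "i \<in> B"
    and same_source: "s i a = s i b"
  shows "preserves_at i (s i a)"
proof -
  have "t i a \<noteq> t i b" using pair_eqD[of i a i b] ab i same_source by auto
  then have t: "t x i = s i a" if "x \<in> B" "x \<noteq> i" for x
    using head_to_tail[of i a x i] head_to_tail[of i b x i] ab i that same_source by auto
  have "s a i \<noteq> s b i" using pair_eqD[of a i b i] ab i t by auto
  then have "s i x = s i a" if "x \<in> B" "x \<noteq> i" for x
    using head_to_tail[of i x a i] head_to_tail[of i x b i] ab i that t by auto
  then show ?thesis using t unfolding preserves_at_def by simp
qed

lemma preserves_or_reverses_at:
  assumes i: "i \<in> B"
  shows "\<exists>p. preserves_at i p \<or> reverses_at i p"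
proof -
  interpret swap: head_to_tail_map B t s by (rule swap)
  obtain a b where ab: "a \<in> B" "b \<in> B" "a \<noteq> i" "b \<noteq> i" "a \<noteq> b" using three_others[OF i] .
  then consider "s i a = s i b" | "t i a = t i b" using same_source_image[of i a b] i by auto
  then show ?thesis
  proof cases
    case 1
    then show ?thesis using preserves_at_if_same_source ab i by blast
  next
    case 2
    then have "swap.preserves_at i (t i a)" using swap.preserves_at_if_same_source ab i by blast
    then show ?thesis unfolding swap.preserves_at_def reverses_at_def by blast
  qed
qed

lemma not_preserves_at_reverses_at:
  assumes "i \<in> B" "j \<in> B" "i \<noteq> j" "preserves_at i p" "reverses_at j q"
  shows False
proof -
  obtain a b c where "a \<in> B" "b \<in> B" "a \<noteq> i" "b \<noteq> i" "a \<noteq> b" using three_others[OF assms(1)] .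
  then obtain x where x: "x \<in> B" "x \<noteq> i" "x \<noteq> j" by metis
  then have "t x i = p" "s i j = p" using assms(2-4) unfolding preserves_at_def by auto
  moreover have "s x j = q" "s i j = q" using assms(1,3,5) x unfolding reverses_at_def by auto
  ultimately show False using head_to_tail[of x j x i] assms(1,2) x by simp
qed

lemma preserves_or_reverses:
  obtains \<tau> where "\<And>i. i \<in> B \<Longrightarrow> preserves_at i (\<tau> i)"
  | \<tau> where "\<And>i. i \<in> B \<Longrightarrow> reverses_at i (\<tau> i)"
proof -
  obtain \<tau> where \<tau>: "\<forall>i\<in>B. preserves_at i (\<tau> i) \<or> reverses_at i (\<tau> i)"
    using bchoice[of B "\<lambda>i p. preserves_at i p \<or> reverses_at i p"] preserves_or_reverses_at by blast
  then have "(\<forall>i\<in>B. preserves_at i (\<tau> i)) \<or> (\<forall>i\<in>B. reverses_at i (\<tau> i))"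
    using not_preserves_at_reverses_at by metis
  then show ?thesis using that by blast
qed

end

lemma eq_image_if_separates:
  assumes "X \<noteq> {}" "X \<subset> B" "Y \<subseteq> \<tau> ` B"
    and "\<And>i j. i \<in> X \<Longrightarrow> j \<in> B - X \<Longrightarrow> \<tau> i \<in> Y \<and> \<tau> j \<notin> Y"
  shows "Y = \<tau> ` X"
  using assms by blast

locale separating_bijection =
  fixes B :: "'a set" and B' :: "'b set" and m :: nat and \<sigma> :: "'a set \<Rightarrow> 'b set"
    and s t :: "'a \<Rightarrow> 'a \<Rightarrow> 'b"
  assumes finite: "finite B" "finite B'" and card_eq: "card B' = card B"
    and m_bounds: "2 \<le> m" "m + 2 \<le> card B"
    and bij_nsets: "bij_betw \<sigma> ([B]\<^bsup>m\<^esup>) ([B']\<^bsup>m\<^esup>)"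
    and s_t_mem: "\<lbrakk>i \<in> B; j \<in> B; i \<noteq> j\<rbrakk> \<Longrightarrow> s i j \<in> B' \<and> t i j \<in> B' \<and> s i j \<noteq> t i j"
    and image_separating:
      "\<lbrakk>i \<in> B; j \<in> B; i \<noteq> j\<rbrakk> \<Longrightarrow> \<sigma> ` separating B m i j = separating B' m (s i j) (t i j)"
begin

sublocale head_to_tail_map B s t
proof
  show "4 \<le> card B" using m_bounds by simp
  show "s i j \<noteq> t i j" if "i \<in> B" "j \<in> B" "i \<noteq> j" for i j using s_t_mem that by blast
  show "s i j = t k l \<or> t i j = s k l \<longleftrightarrow> i = l \<or> j = k"
    if ijkl: "i \<in> B" "j \<in> B" "i \<noteq> j" "k \<in> B" "l \<in> B" "k \<noteq> l" for i j k l
  proof -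
    have "i = l \<or> j = k \<longleftrightarrow> separating B m i j \<inter> separating B m k l = {}"
      using separating_disjoint_iff[OF finite(1) m_bounds ijkl] by simp
    also have "\<dots> \<longleftrightarrow> \<sigma> ` separating B m i j \<inter> \<sigma> ` separating B m k l = {}"
      using inj_on_image_Int[OF bij_betw_imp_inj_on[OF bij_nsets]] separating_subset_nsets
      by (metis image_is_empty)
    also have "\<dots> \<longleftrightarrow> s i j = t k l \<or> t i j = s k l"
      using separating_disjoint_iff[OF finite(2) m_bounds(1)] m_bounds(2) card_eq s_t_mem ijkl
      by (simp add: image_separating)
    finally show ?thesis by blast
  qed
qed

lemma image_in_nsets: "X \<in> [B]\<^bsup>m\<^esup> \<Longrightarrow> \<sigma> X \<in> [B']\<^bsup>m\<^esup>"
  using bij_nsets by (rule bij_betw_apply)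

lemma mem_separating_iff:
  assumes "X \<in> [B]\<^bsup>m\<^esup>" "i \<in> B" "j \<in> B" "i \<noteq> j"
  shows "i \<in> X \<and> j \<notin> X \<longleftrightarrow> s i j \<in> \<sigma> X \<and> t i j \<notin> \<sigma> X"
proof -
  have "X \<in> separating B m i j \<longleftrightarrow> \<sigma> X \<in> \<sigma> ` separating B m i j"
    using inj_on_image_mem_iff[OF bij_betw_imp_inj_on[OF bij_nsets] assms(1)]
      separating_subset_nsets by metis
  then show ?thesis
    using image_separating[OF assms(2-4)] assms(1) image_in_nsets[OF assms(1)]
    unfolding separating_def by simp
qed

lemma nset_nonempty_psubset:
  assumes "X \<in> [B]\<^bsup>m\<^esup>"
  shows "X \<noteq> {}" "X \<subset> B"
  using assms m_bounds unfolding nsets_def by auto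

lemma bij_betw_if_pairs:
  assumes "\<And>i j. \<lbrakk>i \<in> B; j \<in> B; i \<noteq> j\<rbrakk> \<Longrightarrow> {s i j, t i j} = {\<tau> i, \<tau> j}"
  shows "bij_betw \<tau> B B'"
proof -
  have "inj_on \<tau> B" using assms s_neq_t by (intro inj_onI) (metis doubleton_eq_iff)
  moreover have "\<tau> ` B \<subseteq> B'"
  proof
    fix b assume "b \<in> \<tau> ` B"
    then obtain i where "i \<in> B" "b = \<tau> i" by blast
    moreover obtain j where "j \<in> B" "j \<noteq> i" using three_others[OF \<open>i \<in> B\<close>] by metis
    ultimately have "b \<in> {s i j, t i j}" "s i j \<in> B'" "t i j \<in> B'" using assms s_t_mem by simp_all
    then show "b \<in> B'" by auto
  qed
  ultimately show ?thesis
    using card_image finite(2) card_eq card_subset_eq unfolding bij_betw_def by metis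
qed

lemma image_if_preserves:
  assumes "\<And>i. i \<in> B \<Longrightarrow> preserves_at i (\<tau> i)"
  shows "bij_betw \<tau> B B'" "\<And>X. X \<in> [B]\<^bsup>m\<^esup> \<Longrightarrow> \<sigma> X = \<tau> ` X"
proof -
  have st_eq: "s i j = \<tau> i" "t i j = \<tau> j" if "i \<in> B" "j \<in> B" "i \<noteq> j" for i j
    using assms that unfolding preserves_at_def by auto
  then show bij: "bij_betw \<tau> B B'" by (intro bij_betw_if_pairs) simp
  show "\<sigma> X = \<tau> ` X" if X: "X \<in> [B]\<^bsup>m\<^esup>" for X
  proof (rule eq_image_if_separates[OF nset_nonempty_psubset[OF X]])
    show "\<sigma> X \<subseteq> \<tau> ` B" using image_in_nsets[OF X] bij unfolding nsets_def bij_betw_def by simp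
    show "\<tau> i \<in> \<sigma> X \<and> \<tau> j \<notin> \<sigma> X" if "i \<in> X" "j \<in> B - X" for i j
      using mem_separating_iff[OF X, of i j] st_eq[of i j] nset_nonempty_psubset(2)[OF X] that
      by auto
  qed
qed

lemma image_if_reverses:
  assumes "\<And>i. i \<in> B \<Longrightarrow> reverses_at i (\<tau> i)"
  shows "bij_betw \<tau> B B'" "card B = 2 * m" "\<And>X. X \<in> [B]\<^bsup>m\<^esup> \<Longrightarrow> \<sigma> X = B' - \<tau> ` X"
proof -
  have st_eq: "s i j = \<tau> j" "t i j = \<tau> i" if "i \<in> B" "j \<in> B" "i \<noteq> j" for i j
    using assms that unfolding reverses_at_def by auto
  then show bij: "bij_betw \<tau> B B'" by (intro bij_betw_if_pairs) (simp add: insert_commute)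
  have compl: "B' - \<sigma> X = \<tau> ` X" if X: "X \<in> [B]\<^bsup>m\<^esup>" for X
  proof (rule eq_image_if_separates[OF nset_nonempty_psubset[OF X]])
    show "B' - \<sigma> X \<subseteq> \<tau> ` B" using bij unfolding bij_betw_def by simp
    show "\<tau> i \<in> B' - \<sigma> X \<and> \<tau> j \<notin> B' - \<sigma> X" if "i \<in> X" "j \<in> B - X" for i j
      using mem_separating_iff[OF X, of i j] st_eq[of i j] nset_nonempty_psubset(2)[OF X] bij that
      unfolding bij_betw_def by auto
  qed
  then show "\<sigma> X = B' - \<tau> ` X" if "X \<in> [B]\<^bsup>m\<^esup>" for X
    using that image_in_nsets[OF that] unfolding nsets_def by blast
  obtain X where X: "X \<in> [B]\<^bsup>m\<^esup>" using nset_between[of B "{}" "{}" m] finite m_bounds by auto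
  have "card (B' - \<sigma> X) = card B - m"
    using image_in_nsets[OF X] card_eq card_Diff_subset[of "\<sigma> X" B'] unfolding nsets_def by simp
  moreover have "card (\<tau> ` X) = m"
    using X bij inj_on_subset[of \<tau> B X] unfolding nsets_def bij_betw_def by (simp add: card_image)
  ultimately show "card B = 2 * m" using compl[OF X] m_bounds by simp
qed

lemma image_or_complement:
  obtains \<tau> where "bij_betw \<tau> B B'" "\<forall>X\<in>[B]\<^bsup>m\<^esup>. \<sigma> X = \<tau> ` X"
  | \<tau> where "bij_betw \<tau> B B'" "card B = 2 * m" "\<forall>X\<in>[B]\<^bsup>m\<^esup>. \<sigma> X = B' - \<tau> ` X"
  using preserves_or_reverses image_if_preserves image_if_reverses by metis

end

section \<open>Spans in linear spaces\<close>

lemma span_eq_hull: "span P L X = subspace P L hull X"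
  by (simp add: span_def hull_def)

lemma span_superset: "X \<subseteq> span P L X"
  unfolding span_eq_hull by (rule hull_subset)

lemma span_base: "x \<in> X \<Longrightarrow> x \<in> span P L X"
  unfolding span_eq_hull by (rule hull_inc)

lemma span_minimal: "X \<subseteq> S \<Longrightarrow> subspace P L S \<Longrightarrow> span P L X \<subseteq> S"
  unfolding span_eq_hull by (rule hull_minimal)

lemma span_mono: "X \<subseteq> Y \<Longrightarrow> span P L X \<subseteq> span P L Y"
  unfolding span_eq_hull by (rule hull_mono)

lemma span_eq_self: "subspace P L S \<Longrightarrow> span P L S = S"
  unfolding span_eq_hull by (rule hull_same)

lemma span_insert_span: "span P L (insert x (span P L X)) = span P L (insert x X)"
  unfolding span_eq_hull by (rule hull_insert[symmetric])

lemma span_subset_span: "Y \<subseteq> span P L X \<Longrightarrow> span P L Y \<subseteq> span P L X"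
  unfolding span_eq_hull by (metis hull_hull hull_mono)

lemma span_eq_span: "Y \<subseteq> span P L X \<Longrightarrow> X \<subseteq> span P L Y \<Longrightarrow> span P L Y = span P L X"
  by (simp add: span_subset_span subset_antisym)

locale linear_geometry =
  fixes P :: "'a set" and L :: "'a set set"
  assumes linear_space: "linear_space P L"
begin

abbreviation cl :: "'a set \<Rightarrow> 'a set" where
  "cl \<equiv> span P L"

abbreviation spans :: "nat \<Rightarrow> 'a set \<Rightarrow> 'a set set" where
  "spans m B \<equiv> cl ` [B]\<^bsup>m\<^esup>"

lemma line_subset: "l \<in> L \<Longrightarrow> l \<subset> P"
  using linear_space unfolding linear_space_def by blast

lemma line_exists:
  assumes "p \<in> P" "q \<in> P" "p \<noteq> q"
  obtains l where "l \<in> L" "p \<in> l" "q \<in> l"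
  using linear_space assms unfolding linear_space_def by metis

lemma line_unique:
  assumes "l \<in> L" "l' \<in> L" "p \<in> l" "q \<in> l" "p \<in> l'" "q \<in> l'" "p \<noteq> q"
  shows "l = l'"
proof -
  have "p \<in> P" "q \<in> P" using assms line_subset by blast+
  then have "\<exists>!l. l \<in> L \<and> p \<in> l \<and> q \<in> l"
    using linear_space \<open>p \<noteq> q\<close> unfolding linear_space_def by simp
  then show ?thesis using assms by blast
qed

lemma subspace_lineD:
  "\<lbrakk>subspace P L S; l \<in> L; x \<in> S; y \<in> S; x \<noteq> y; x \<in> l; y \<in> l\<rbrakk> \<Longrightarrow> l \<subseteq> S"
  unfolding subspace_def by simp

lemma subspace_subset: "subspace P L S \<Longrightarrow> S \<subseteq> P"
  unfolding subspace_def by simp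

lemma subspace_carrier: "subspace P L P"
  using line_subset unfolding subspace_def by blast

lemma subspace_empty: "subspace P L {}"
  unfolding subspace_def by simp

lemma subspace_singleton: "x \<in> P \<Longrightarrow> subspace P L {x}"
  unfolding subspace_def by auto

lemma subspace_line: "l \<in> L \<Longrightarrow> subspace P L l"
  unfolding subspace_def using line_unique line_subset by (metis order_refl psubset_imp_subset)

lemma subspace_Inter:
  assumes "\<And>S. S \<in> \<S> \<Longrightarrow> subspace P L S"
  shows "subspace P L (P \<inter> \<Inter>\<S>)"
proof -
  have "l \<subseteq> P \<inter> \<Inter>\<S>"
    if l: "l \<in> L" "p \<in> P \<inter> \<Inter>\<S>" "q \<in> P \<inter> \<Inter>\<S>" "p \<noteq> q" "p \<in> l" "q \<in> l" for l p q
  proof -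
    have "l \<subseteq> S" if S: "S \<in> \<S>" for S
      using subspace_lineD[OF assms[OF S] l(1) _ _ l(4-6)] S l(2,3) by blast
    then show ?thesis using line_subset[OF l(1)] by blast
  qed
  then show ?thesis unfolding subspace_def by simp
qed

lemma subspace_Int: "subspace P L S \<Longrightarrow> subspace P L T \<Longrightarrow> subspace P L (S \<inter> T)"
  unfolding subspace_def by (metis IntD1 IntD2 le_infI1 le_inf_iff)

lemma span_subset_carrier: "X \<subseteq> P \<Longrightarrow> cl X \<subseteq> P"
  by (simp add: span_minimal subspace_carrier)

lemma subspace_span:
  assumes "X \<subseteq> P"
  shows "subspace P L (cl X)"
proof -
  have "subspace P L (P \<inter> \<Inter>{S. subspace P L S \<and> X \<subseteq> S})"
    by (rule subspace_Inter) simp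
  moreover have "P \<inter> \<Inter>{S. subspace P L S \<and> X \<subseteq> S} = cl X"
    using span_subset_carrier[OF assms] by (auto simp: span_def)
  ultimately show ?thesis by simp
qed

lemma span_empty: "cl {} = {}"
  by (simp add: span_eq_self subspace_empty)

lemma span_singleton: "x \<in> P \<Longrightarrow> cl {x} = {x}"
  by (simp add: span_eq_self subspace_singleton)

lemma span_pair_eq_line:
  assumes "l \<in> L" "x \<in> l" "y \<in> l" "x \<noteq> y"
  shows "cl {x, y} = l"
proof
  show "cl {x, y} \<subseteq> l" using assms by (simp add: span_minimal subspace_line)
  have "{x, y} \<subseteq> P" using assms line_subset by blast
  then show "l \<subseteq> cl {x, y}"
    using assms subspace_lineD[OF subspace_span, of "{x, y}" l x y] by (simp add: span_base)
qed

lemma span_pair_line: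
  assumes "x \<in> P" "y \<in> P" "x \<noteq> y"
  shows "cl {x, y} \<in> L"
  using line_exists[OF assms] span_pair_eq_line assms(3) by metis

lemma span_pair_eq_span_pair:
  assumes "{a, b} \<subseteq> P" "x \<in> cl {a, b}" "y \<in> cl {a, b}" "x \<noteq> y"
  shows "cl {x, y} = cl {a, b}"
proof (cases "a = b")
  case True
  then show ?thesis using assms span_singleton by auto
next
  case False
  then have "cl {a, b} \<in> L" using assms(1) span_pair_line by simp
  then show ?thesis using assms span_pair_eq_line by blast
qed

lemma span_pair_exchange:
  assumes "x \<in> P" "h \<in> P" "y \<in> cl {x, h}" "y \<noteq> h"
  shows "x \<in> cl {y, h}"
  using assms span_pair_eq_span_pair[of x h y h] by (simp add: span_base)

lemma span_replace_on_line:
  assumes "i \<in> P" "j \<in> P" "p \<in> cl {i, j}" "p \<noteq> j" "i \<in> X" "j \<in> X" "i \<noteq> j"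
  shows "cl (insert p (X - {i})) = cl X"
proof (rule span_eq_span)
  show "insert p (X - {i}) \<subseteq> cl X"
    using assms(3,5,6) span_mono[of "{i, j}" X P L] span_superset[of X P L] by blast
  have "i \<in> cl {p, j}" using assms(1-4) by (rule span_pair_exchange)
  then show "X \<subseteq> cl (insert p (X - {i}))"
    using assms(5-7) span_mono[of "{p, j}" "insert p (X - {i})" P L]
      span_superset[of "insert p (X - {i})" P L] by blast
qed

lemma subspaceI_span_pair:
  assumes "S \<subseteq> P" "\<And>x y. x \<in> S \<Longrightarrow> y \<in> S \<Longrightarrow> cl {x, y} \<subseteq> S"
  shows "subspace P L S"
  using assms span_pair_eq_line unfolding subspace_def by metis

lemma collinear_iff_span:
  assumes "L \<noteq> {}" "x \<in> P" "y \<in> P" "z \<in> P"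
  shows "collinear L {x, y, z} \<longleftrightarrow> x = y \<or> z \<in> cl {x, y}"
proof (cases "x = y")
  case True
  have "\<exists>l\<in>L. {x, z} \<subseteq> l"
  proof (cases "x = z")
    case True
    obtain m where m: "m \<in> L" using assms(1) by blast
    then obtain p q where "p \<in> m" "q \<in> m" "p \<noteq> q"
      using linear_space unfolding linear_space_def by metis
    then obtain w where "w \<in> P" "w \<noteq> x" using line_subset[OF m] by blast
    then obtain l where "l \<in> L" "x \<in> l" using assms(2) line_exists by metis
    then show ?thesis using True by auto
  next
    case False
    then obtain l where "l \<in> L" "x \<in> l" "z \<in> l" using assms line_exists by metis
    then show ?thesis by auto
  qed
  then show ?thesis using True unfolding collinear_def by simp
next
  case False
  then have line: "cl {x, y} \<in> L" using assms span_pair_line by simp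
  have "collinear L {x, y, z} \<longleftrightarrow> z \<in> cl {x, y}"
  proof
    assume "collinear L {x, y, z}"
    then show "z \<in> cl {x, y}" using span_pair_eq_line False unfolding collinear_def by force
  next
    assume "z \<in> cl {x, y}"
    then have "{x, y, z} \<subseteq> cl {x, y}" by (simp add: span_base)
    then show "collinear L {x, y, z}" using line unfolding collinear_def by blast
  qed
  then show ?thesis using False by simp
qed

lemma span_card_le_2_subset_span_pair:
  assumes X: "X \<subseteq> P" "finite X" "card X \<le> 2" and xy: "x \<in> cl X" "y \<in> cl X" "x \<noteq> y"
  shows "cl X \<subseteq> cl {x, y}"
proof -
  have "2 \<le> card (X \<union> {x, y})"
    using X(2) card_mono[of "X \<union> {x, y}" "{x, y}"] \<open>x \<noteq> y\<close> by simp
  then obtain T where T: "X \<subseteq> T" "T \<subseteq> X \<union> {x, y}" "card T = 2"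
    using exists_subset_between[of X 2 "X \<union> {x, y}"] X by auto
  then obtain a b where "T = {a, b}" by (auto simp: card_2_iff)
  then have ab: "{a, b} \<subseteq> P" "X \<subseteq> {a, b}"
    using T(1,2) X(1) xy span_subset_carrier[OF X(1)] by blast+
  then have "cl X \<subseteq> cl {a, b}" by (simp add: span_mono)
  also have "\<dots> = cl {x, y}"
    using span_pair_eq_span_pair[OF ab(1)] xy \<open>cl X \<subseteq> cl {a, b}\<close> by blast
  finally show ?thesis .
qed

lemma has_dim_plane:
  assumes "x \<in> P" "y \<in> P" "z \<in> P" and "x \<noteq> y" "z \<notin> cl {x, y}"
  shows "has_dim P L (cl {x, y, z}) 2"
  unfolding has_dim_def
proof (intro conjI allI impI exI[of _ "{x, y, z}"])
  show "subspace P L (cl {x, y, z})" "{x, y, z} \<subseteq> P" using assms by (simp_all add: subspace_span)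
  have "z \<noteq> x" "z \<noteq> y" using assms(5) span_base[of _ "{x, y}"] by auto
  then show "card {x, y, z} = Suc 2" using assms(4) by simp
  show "Suc 2 \<le> card X" if "X \<subseteq> P" "finite X" "cl X = cl {x, y, z}" for X
  proof (rule ccontr)
    assume "\<not> Suc 2 \<le> card X"
    then have "cl X \<subseteq> cl {x, y}"
      using that assms(4) by (intro span_card_le_2_subset_span_pair) (simp_all add: span_base)
    then show False using that(3) assms(5) by (simp add: span_base subset_iff)
  qed
qed simp_all

end

section \<open>Linear spaces with the exchange property\<close>

locale exchange_geometry = linear_geometry P L for P :: "'a set" and L :: "'a set set" +
  assumes exchange:
    "\<lbrakk>finite A; A \<subseteq> P; x \<in> P; y \<in> cl (insert x A); y \<notin> cl A\<rbrakk> \<Longrightarrow> x \<in> cl (insert y A)"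
begin

text \<open>Only finite sets are called independent here; in a space of finite dimension this agrees
  with \<^const>\<open>independent\<close>.\<close>

definition indep :: "'a set \<Rightarrow> bool" where
  "indep X \<longleftrightarrow> X \<subseteq> P \<and> finite X \<and> (\<forall>x\<in>X. x \<notin> cl (X - {x}))"

definition base :: "'a set \<Rightarrow> bool" where
  "base B \<longleftrightarrow> indep B \<and> cl B = P"

lemma indepD:
  assumes "indep X"
  shows "X \<subseteq> P" "finite X" "\<And>x. x \<in> X \<Longrightarrow> x \<notin> cl (X - {x})"
  using assms unfolding indep_def by auto

lemma baseD:
  assumes "base B"
  shows "indep B" "cl B = P" "B \<subseteq> P" "finite B"
  using assms unfolding base_def by (auto dest: indepD)

lemma indep_empty: "indep {}"
  unfolding indep_def by simp

lemma indep_mono: "indep X \<Longrightarrow> Y \<subseteq> X \<Longrightarrow> indep Y"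
  unfolding indep_def by (meson Diff_mono finite_subset order_refl span_mono subsetD subset_trans)

lemma indep_span_mem_iff:
  assumes "indep B" "X \<subseteq> B" "b \<in> B"
  shows "b \<in> cl X \<longleftrightarrow> b \<in> X"
proof
  assume "b \<in> cl X"
  show "b \<in> X"
  proof (rule ccontr)
    assume "b \<notin> X"
    then have "cl X \<subseteq> cl (B - {b})" using assms(2) by (intro span_mono) blast
    then show False using \<open>b \<in> cl X\<close> assms indepD(3) by blast
  qed
qed (rule span_base)

lemma inj_on_span_indep:
  assumes "indep B"
  shows "inj_on cl (Pow B)"
proof (rule inj_onI)
  fix X Y assume "X \<in> Pow B" "Y \<in> Pow B" "cl X = cl Y"
  then have "b \<in> X \<longleftrightarrow> b \<in> Y" if "b \<in> B" for b
    using indep_span_mem_iff[OF assms _ that] by auto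
  then show "X = Y" using \<open>X \<in> Pow B\<close> \<open>Y \<in> Pow B\<close> by blast
qed

lemma inj_on_span_nsets: "indep B \<Longrightarrow> inj_on cl ([B]\<^bsup>m\<^esup>)"
  by (rule inj_on_subset[OF inj_on_span_indep]) (auto simp: nsets_def)

lemma indep_insert:
  assumes I: "indep I" and y: "y \<in> P" "y \<notin> cl I"
  shows "indep (insert y I)"
proof -
  have "y \<notin> I" using y(2) span_base by metis
  have "x \<notin> cl (insert y I - {x})" if x: "x \<in> insert y I" for x
  proof (cases "x = y")
    case True
    then show ?thesis using y \<open>y \<notin> I\<close> by simp
  next
    case False
    then have "x \<in> I" using x by simp
    show ?thesis
    proof
      assume "x \<in> cl (insert y I - {x})"
      then have "x \<in> cl (insert y (I - {x}))" using False by (simp add: insert_Diff_if)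
      then have "y \<in> cl (insert x (I - {x}))"
        using exchange[of "I - {x}" y x] indepD[OF I] y(1) \<open>x \<in> I\<close> by blast
      then show False using y(2) \<open>x \<in> I\<close> by (simp add: insert_absorb)
    qed
  qed
  then show ?thesis using I y(1) unfolding indep_def by blast
qed

lemma indep_insert_iff:
  assumes "x \<notin> I"
  shows "indep (insert x I) \<longleftrightarrow> indep I \<and> x \<in> P \<and> x \<notin> cl I"
proof
  assume "indep (insert x I)"
  then show "indep I \<and> x \<in> P \<and> x \<notin> cl I"
    using assms indep_span_mem_iff[of "insert x I" I x] by (auto dest: indepD intro: indep_mono)
qed (simp add: indep_insert)

lemma indep_singleton: "x \<in> P \<Longrightarrow> indep {x}"
  by (simp add: indep_insert indep_empty span_empty)

lemma indep_pair: "x \<in> P \<Longrightarrow> y \<in> P \<Longrightarrow> indep {x, y}"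
  using indep_insert[of "{y}" x] by (cases "x = y") (simp_all add: indep_singleton span_singleton)

lemma indep_card_le_span:
  assumes "indep I" "finite F" "F \<subseteq> P" "I \<subseteq> cl F"
  shows "card I \<le> card F"
  using assms
proof (induction "card (I - F)" arbitrary: I rule: less_induct)
  case less
  show ?case
  proof (cases "I \<subseteq> F")
    case True
    then show ?thesis using less.prems card_mono by blast
  next
    case False
    then obtain y where y: "y \<in> I" "y \<notin> F" by blast
    have "\<not> F \<subseteq> cl (I - {y})"
      using span_subset_span[of F P L "I - {y}"] less.prems(4) indepD(3)[OF less.prems(1) y(1)] y(1)
      by blast
    then obtain z where z: "z \<in> F" "z \<notin> cl (I - {y})" by blast
    have "finite I" using indepD(2)[OF less.prems(1)] .
    have "z \<notin> I - {y}" using z(2) span_base by metis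
    let ?I = "insert z (I - {y})"
    have "indep ?I"
      using less.prems z by (intro indep_insert indep_mono[OF less.prems(1)]) auto
    moreover have "?I \<subseteq> cl F" using less.prems(4) z(1) span_superset[of F P L] by blast
    moreover have "card (?I - F) < card (I - F)"
      using y z \<open>finite I\<close> by (intro psubset_card_mono) auto
    ultimately have "card ?I \<le> card F" using less by blast
    moreover have "card ?I = card I"
      using \<open>z \<notin> I - {y}\<close> \<open>finite I\<close> y(1) by (metis card.remove card_insert_disjoint finite_Diff)
    ultimately show ?thesis by simp
  qed
qed

lemma indep_card_eq:
  assumes "indep I" "indep J" "cl I = cl J"
  shows "card I = card J"
proof (rule antisym)
  show "card I \<le> card J" using assms indepD span_superset by (metis indep_card_le_span)
  show "card J \<le> card I" using assms indepD span_superset by (metis indep_card_le_span)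
qed

lemma indep_extend:
  assumes "indep I" "I \<subseteq> A" "A \<subseteq> cl F" "finite F" "F \<subseteq> P"
  obtains J where "I \<subseteq> J" "J \<subseteq> A" "indep J" "cl J = cl A"
proof -
  let ?\<I> = "{J. indep J \<and> I \<subseteq> J \<and> J \<subseteq> A}"
  have bound: "card J < Suc (card F)" if "J \<in> ?\<I>" for J
    using that assms indep_card_le_span[of J F] subset_trans[of J A "cl F"] by auto
  have "\<exists>J. J \<in> ?\<I> \<and> (\<forall>K. K \<in> ?\<I> \<longrightarrow> card K \<le> card J)"
  proof (rule ex_has_greatest_nat)
    show "I \<in> ?\<I>" using assms(1,2) by simp
    show "\<forall>J. J \<in> ?\<I> \<longrightarrow> card J < Suc (card F)" using bound by blast
  qed
  then obtain J where J: "J \<in> ?\<I>" and max: "\<And>K. K \<in> ?\<I> \<Longrightarrow> card K \<le> card J"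
    by blast
  have "A \<subseteq> cl J"
  proof (rule subsetI, rule ccontr)
    fix y assume y: "y \<in> A" "y \<notin> cl J"
    have "y \<in> P" using y(1) assms(3,5) span_subset_carrier by blast
    then have "insert y J \<in> ?\<I>" using J y indep_insert by blast
    moreover have "y \<notin> J" using y(2) span_base by metis
    ultimately show False using max[of "insert y J"] J indepD(2)[of J] by simp
  qed
  then have "cl J = cl A" using J span_superset[of A P L] by (intro span_eq_span) auto
  then show ?thesis using that J by blast
qed

lemma Gr_iff: "S \<in> Gr P L m \<longleftrightarrow> (\<exists>I. indep I \<and> card I = Suc m \<and> cl I = S)"
proof
  assume "S \<in> Gr P L m"
  then obtain X where X: "X \<subseteq> P" "finite X" "card X = Suc m" "cl X = S"
    and min: "\<And>Y. Y \<subseteq> P \<Longrightarrow> finite Y \<Longrightarrow> cl Y = S \<Longrightarrow> Suc m \<le> card Y"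
    unfolding Gr_def has_dim_def by blast
  obtain J where J: "J \<subseteq> X" "indep J" "cl J = cl X"
    by (rule indep_extend[OF indep_empty empty_subsetI span_superset X(2,1)])
  then have "Suc m \<le> card J" using min[of J] X(4) indepD(1,2)[of J] by simp
  then have "J = X" using J(1) X(2,3) card_seteq by metis
  then show "\<exists>I. indep I \<and> card I = Suc m \<and> cl I = S" using J X by blast
next
  assume "\<exists>I. indep I \<and> card I = Suc m \<and> cl I = S"
  then obtain I where I: "indep I" "card I = Suc m" "cl I = S" by blast
  have "Suc m \<le> card X" if "X \<subseteq> P" "finite X" "cl X = S" for X
    using that I span_superset[of I P L] indep_card_le_span[of I X] by simp
  then show "S \<in> Gr P L m"
    unfolding Gr_def has_dim_def using I indepD[OF I(1)] subspace_span[of I] by auto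
qed

lemma Gr_subspace: "S \<in> Gr P L m \<Longrightarrow> subspace P L S"
  by (simp add: Gr_def has_dim_def)

lemma Gr_nonempty: "S \<in> Gr P L m \<Longrightarrow> S \<noteq> {}"
  unfolding Gr_iff by (metis card.empty nat.distinct(1) span_superset subset_empty)

lemma Gr_base_extending:
  assumes "S \<in> Gr P L m" "indep I" "I \<subseteq> S"
  obtains J where "I \<subseteq> J" "indep J" "card J = Suc m" "cl J = S"
proof -
  obtain K where K: "indep K" "card K = Suc m" "cl K = S" using assms(1) Gr_iff by blast
  obtain J where "I \<subseteq> J" "J \<subseteq> S" "indep J" "cl J = cl S"
    using indep_extend[OF assms(2,3), of K] K indepD[OF K(1)] by blast
  moreover have "cl S = S" using Gr_subspace[OF assms(1)] by (rule span_eq_self)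
  ultimately show ?thesis using that indep_card_eq[of J K] K by simp
qed

lemma Gr_subset_eq:
  assumes "S \<in> Gr P L m" "T \<in> Gr P L m" "S \<subseteq> T"
  shows "S = T"
proof -
  obtain I where I: "indep I" "card I = Suc m" "cl I = S" using assms(1) Gr_iff by blast
  then have "I \<subseteq> T" using assms(3) span_superset[of I P L] by blast
  then obtain J where J: "I \<subseteq> J" "indep J" "card J = Suc m" "cl J = T"
    using Gr_base_extending assms(2) I(1) by blast
  then have "I = J" using I(2) indepD(2) by (simp add: card_subset_eq)
  then show ?thesis using I J by simp
qed

lemma Gr_insert:
  assumes "S \<in> Gr P L m" "x \<in> P" "x \<notin> S"
  shows "cl (insert x S) \<in> Gr P L (Suc m)"
proof -
  obtain I where I: "indep I" "card I = Suc m" "cl I = S" using assms(1) Gr_iff by blast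
  then have "indep (insert x I)" using indep_insert assms(2,3) by blast
  moreover have "x \<notin> I" using assms(3) I(3) span_base by metis
  then have "card (insert x I) = Suc (Suc m)" using I indepD(2) by simp
  moreover have "cl (insert x S) = cl (insert x I)" using span_insert_span I(3) by metis
  ultimately show ?thesis using Gr_iff by blast
qed

definition support :: "'a set \<Rightarrow> 'a \<Rightarrow> 'a set" where
  "support B z = \<Inter>{X. X \<subseteq> B \<and> z \<in> cl X}"

text \<open>By the exchange property, a minimal subset of \<open>B\<close> spanning \<open>z\<close> is contained in every
  subset of \<open>B\<close> spanning \<open>z\<close>.\<close>

lemma mem_span_iff_support:
  assumes B: "indep B" and z: "z \<in> cl B" and X: "X \<subseteq> B"
  shows "z \<in> cl X \<longleftrightarrow> support B z \<subseteq> X"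
proof -
  let ?\<C> = "{C. C \<subseteq> B \<and> z \<in> cl C}"
  have "finite ?\<C>" "B \<in> ?\<C>" using indepD(2)[OF B] z by simp_all
  then obtain C where C: "C \<subseteq> B" "z \<in> cl C"
    and min: "\<And>D. D \<subseteq> B \<Longrightarrow> z \<in> cl D \<Longrightarrow> D \<subseteq> C \<Longrightarrow> C = D"
    using finite_has_minimal2[of ?\<C> B] by auto
  have least: "C \<subseteq> Y" if Y: "Y \<subseteq> B" "z \<in> cl Y" for Y
  proof
    fix c assume c: "c \<in> C"
    have "z \<notin> cl (C - {c})" using min[of "C - {c}"] c C(1) by blast
    moreover have "finite C" "C \<subseteq> P" using C(1) indepD(1,2)[OF B] finite_subset by blast+
    ultimately have "c \<in> cl (insert z (C - {c}))"
      using exchange[of "C - {c}" c z] C(2) c by (auto simp: insert_absorb)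
    also have "\<dots> \<subseteq> cl ((C - {c}) \<union> Y)"
      using Y(2) span_mono[of Y "(C - {c}) \<union> Y" P L] span_superset[of "(C - {c}) \<union> Y" P L]
      by (intro span_subset_span) blast
    finally show "c \<in> Y" using indep_span_mem_iff[OF B, of "(C - {c}) \<union> Y" c] c C(1) Y(1) by blast
  qed
  then have "support B z = C" unfolding support_def using C by blast
  then show ?thesis using C least X span_mono[of C X P L] by blast
qed

lemma mem_span_Inter:
  assumes B: "indep B" and "\<X> \<noteq> {}" and \<X>: "\<And>X. X \<in> \<X> \<Longrightarrow> X \<subseteq> B \<and> z \<in> cl X"
  shows "z \<in> cl (\<Inter>\<X>)"
proof -
  obtain X where "X \<in> \<X>" using assms(2) by blast
  then have "z \<in> cl B" "\<Inter>\<X> \<subseteq> B" using \<X> span_mono[of X B P L] by blast+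
  moreover have "support B z \<subseteq> \<Inter>\<X>"
    using \<X> mem_span_iff_support[OF B \<open>z \<in> cl B\<close>] by blast
  ultimately show ?thesis using mem_span_iff_support[OF B] by blast
qed

text \<open>If \<open>b \<in> B\<close> is not in \<open>B'\<close>, then some \<open>c\<close> in the support of \<open>b\<close> with respect to \<open>B'\<close> has a
  point \<open>j \<noteq> b\<close> in its own support with respect to \<open>B\<close>.\<close>

lemma common_span_implied_point:
  assumes B: "base B" and B': "base B'" and b: "b \<in> B" "b \<notin> B'"
  obtains j where "j \<in> B" "j \<noteq> b"
    "\<forall>X Y. X \<subseteq> B \<longrightarrow> Y \<subseteq> B' \<longrightarrow> cl X = cl Y \<longrightarrow> b \<in> X \<longrightarrow> j \<in> X"
proof -
  have "b \<in> P" using b(1) baseD(3)[OF B] by blast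
  then have supp_b: "b \<in> cl Y \<longleftrightarrow> support B' b \<subseteq> Y" if "Y \<subseteq> B'" for Y
    using mem_span_iff_support that baseD[OF B'] by blast
  then obtain c where c: "c \<in> support B' b" using span_empty by blast
  then have "c \<in> B'" using supp_b[of B'] \<open>b \<in> P\<close> baseD(2)[OF B'] by blast
  then have "c \<noteq> b" "c \<in> P" using b(2) baseD(3)[OF B'] by blast+
  have supp_c: "c \<in> cl X \<longleftrightarrow> support B c \<subseteq> X" if "X \<subseteq> B" for X
    using mem_span_iff_support that baseD[OF B] \<open>c \<in> P\<close> by blast
  have "c \<notin> cl {b}" using span_singleton[OF \<open>b \<in> P\<close>] \<open>c \<noteq> b\<close> by simp
  then obtain j where j: "j \<in> support B c" "j \<noteq> b" using supp_c[of "{b}"] b(1) by blast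
  have "j \<in> B" using j(1) supp_c[of B] \<open>c \<in> P\<close> baseD(2)[OF B] by blast
  moreover have "j \<in> X" if "X \<subseteq> B" "Y \<subseteq> B'" "cl X = cl Y" "b \<in> X" for X Y
  proof -
    have "b \<in> cl Y" using that(3,4) span_base by metis
    then have "c \<in> Y" using supp_b[OF that(2)] c by blast
    then have "c \<in> cl X" using that(3) span_base by metis
    then show ?thesis using supp_c[OF that(1)] j(1) by blast
  qed
  ultimately show ?thesis using that j(2) by blast
qed

definition facet :: "'a set \<Rightarrow> 'a \<Rightarrow> 'a set" where
  "facet B b = cl (B - {b})"

lemma inj_on_facet:
  assumes "indep B"
  shows "inj_on (facet B) B"
proof (rule inj_onI)
  fix b c assume bc: "b \<in> B" "c \<in> B" "facet B b = facet B c"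
  then have "B - {b} = B - {c}"
    using inj_onD[OF inj_on_span_indep[OF assms], of "B - {b}" "B - {c}"]
    unfolding facet_def by blast
  then show "b = c" using bc by blast
qed

lemma span_Diff_eq_Inter_facets:
  assumes B: "base B" and Y: "Y \<subseteq> B"
  shows "cl (B - Y) = P \<inter> \<Inter>(facet B ` Y)"
proof -
  have "z \<in> cl (B - Y) \<longleftrightarrow> (\<forall>b\<in>Y. z \<in> facet B b)" if "z \<in> P" for z
  proof -
    have "z \<in> cl X \<longleftrightarrow> support B z \<subseteq> X" if "X \<subseteq> B" for X
      using mem_span_iff_support that \<open>z \<in> P\<close> baseD(1,2)[OF B] by blast
    moreover have "support B z \<subseteq> B" using calculation[of B] \<open>z \<in> P\<close> baseD(2)[OF B] by simp
    ultimately show ?thesis unfolding facet_def by auto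
  qed
  moreover have "cl (B - Y) \<subseteq> P" using baseD(3)[OF B] by (intro span_subset_carrier) blast
  ultimately show ?thesis by blast
qed

end

locale exchange_geometry_of_dim = exchange_geometry P L for P :: "'a set" and L :: "'a set set" +
  fixes n :: nat
  assumes has_dim: "has_dim P L P n"
begin

lemma carrier_in_Gr: "P \<in> Gr P L n"
  using has_dim by (simp add: Gr_def)

lemma base_extending:
  assumes "indep I"
  obtains B where "I \<subseteq> B" "base B"
proof -
  obtain B where "I \<subseteq> B" "indep B" "cl B = P"
    using Gr_base_extending[OF carrier_in_Gr assms indepD(1)[OF assms]] .
  then show ?thesis using that unfolding base_def by blast
qed

lemma base_card:
  assumes "base B"
  shows "card B = Suc n"
  using Gr_base_extending[OF carrier_in_Gr baseD(1,3)[OF assms]]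
    indep_card_eq[OF baseD(1)[OF assms]] baseD(2)[OF assms] by metis

lemma base_eqI:
  assumes "base B" "base B'" "B \<subseteq> B'"
  shows "B = B'"
  using assms card_subset_eq[OF baseD(4)] base_card by metis

lemma base_if_card:
  assumes "indep I" "card I = Suc n"
  shows "base I"
proof -
  obtain B where "I \<subseteq> B" "base B" using base_extending[OF assms(1)] .
  then have "I = B" using assms(2) base_card baseD(4) by (metis card_subset_eq)
  then show ?thesis using \<open>base B\<close> by simp
qed

lemma indep_spanning_subset:
  assumes "A \<subseteq> P"
  obtains J where "J \<subseteq> A" "indep J" "cl J = cl A"
proof -
  obtain B where B: "base B" using base_extending[OF indep_empty] .
  show ?thesis
  proof (rule indep_extend[OF indep_empty empty_subsetI _ baseD(4,3)[OF B]])
    show "A \<subseteq> cl B" using assms baseD(2)[OF B] by simp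
  qed (rule that)
qed

lemma independent_iff_indep: "independent P L X \<longleftrightarrow> indep X"
proof
  assume X: "independent P L X"
  then have "X \<subseteq> P" unfolding independent_def by simp
  then obtain J where "J \<subseteq> X" "indep J" "cl J = cl X" by (rule indep_spanning_subset)
  then show "indep X" using X unfolding independent_def by (metis psubsetI)
next
  assume X: "indep X"
  have "cl Y \<noteq> cl X" if "Y \<subset> X" for Y
    using inj_onD[OF inj_on_span_indep[OF X], of Y X] that by blast
  then show "independent P L X" using indepD(1)[OF X] unfolding independent_def by simp
qed

lemma is_base_iff_base: "is_base P L B \<longleftrightarrow> base B"
  unfolding is_base_def base_def independent_iff_indep by simp

lemma base_subset_of_eq:
  assumes "base B"
  shows "base_subset_of P L k B = spans (Suc k) B"
proof -
  have "cl X \<in> Gr P L k \<longleftrightarrow> card X = Suc k" if "X \<subseteq> B" for X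
  proof -
    have "indep X" using indep_mono baseD(1)[OF assms] that by blast
    then show ?thesis unfolding Gr_iff using indep_card_eq by metis
  qed
  then show ?thesis
    unfolding base_subset_of_def nsets_def using finite_subset[OF _ baseD(4)[OF assms]] by blast
qed

lemma base_replace:
  assumes "base B" "b \<in> B" "c \<in> P" "c \<notin> cl (B - {b})"
  shows "base (insert c (B - {b}))"
proof (rule base_if_card)
  show "indep (insert c (B - {b}))" using assms indep_insert indep_mono baseD(1) by blast
  have "c \<notin> B - {b}" using assms(4) span_base by metis
  then show "card (insert c (B - {b})) = Suc n"
    using assms(1,2) base_card baseD(4) by (metis card.remove card_insert_disjoint finite_Diff)
qed

lemma base_exchange_induct:
  assumes "base B" "base B'" "K \<subseteq> B" "K \<subseteq> B'" "Q B"
    and step: "\<And>C C'. \<lbrakk>base C; base C'; K \<subseteq> C \<inter> C'; card (C \<inter> C') = n; Q C\<rbrakk> \<Longrightarrow> Q C'"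
  shows "Q B'"
  using assms(2,4)
proof (induction "card (B' - B)" arbitrary: B' rule: less_induct)
  case less
  show ?case
  proof (cases "B' \<subseteq> B")
    case True
    then show ?thesis using base_eqI[OF less.prems(1) assms(1)] assms(5) by simp
  next
    case False
    then obtain b where b: "b \<in> B'" "b \<notin> B" by blast
    have "\<not> B \<subseteq> cl (B' - {b})"
      using span_subset_span[of B P L "B' - {b}"] baseD(2)[OF assms(1)] b(1)
        baseD(3)[OF less.prems(1)] indepD(3)[OF baseD(1)[OF less.prems(1)] b(1)] by blast
    then obtain c where c: "c \<in> B" "c \<notin> cl (B' - {b})" by blast
    define C where "C = insert c (B' - {b})"
    have "base C"
      unfolding C_def using less.prems(1) b(1) c baseD(3)[OF assms(1)] by (intro base_replace) auto
    moreover have "c \<notin> B' - {b}" using c(2) span_base by metis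
    then have "C \<inter> B' = B' - {b}" unfolding C_def using b(2) c(1) by blast
    then have "card (C \<inter> B') = n"
      using base_card[OF less.prems(1)] baseD(4)[OF less.prems(1)] b(1) by simp
    moreover have "K \<subseteq> C" unfolding C_def using less.prems(2) assms(3) b(2) by blast
    moreover have "card (C - B) < card (B' - B)"
      unfolding C_def using b c(1) baseD(4)[OF less.prems(1)] by (intro psubset_card_mono) auto
    ultimately show ?thesis using less.hyps[of C] step[of C B'] less.prems by blast
  qed
qed

lemma base_through_pair:
  assumes "x \<in> P" "y \<in> P"
  obtains B where "base B" "x \<in> B" "y \<in> B"
proof -
  obtain B where "{x, y} \<subseteq> B" "base B" using base_extending[OF indep_pair[OF assms]] .
  then show ?thesis using that by simp
qed

lemma lines_nonempty:
  assumes "0 < n"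
  shows "L \<noteq> {}"
proof -
  obtain B where B: "base B" using base_extending[OF indep_empty] .
  have "2 \<le> card B" using base_card[OF B] assms by simp
  then obtain x y where "x \<in> B" "y \<in> B" "x \<noteq> y"
    using card_le_Suc0_iff_eq[OF baseD(4)[OF B]] by fastforce
  then show ?thesis using span_pair_line[of x y] baseD(3)[OF B] by blast
qed

definition edge_point :: "'a set \<Rightarrow> 'a \<Rightarrow> 'a \<Rightarrow> 'a \<Rightarrow> bool" where
  "edge_point B i j p \<longleftrightarrow> base B \<and> i \<in> B \<and> j \<in> B \<and> i \<noteq> j \<and> p \<in> cl {i, j} \<and> p \<noteq> i \<and> p \<noteq> j"

lemma edge_pointD:
  assumes "edge_point B i j p"
  shows "base B" "i \<in> B" "j \<in> B" "i \<noteq> j" "p \<in> cl {i, j}" "p \<noteq> j" "i \<in> P" "j \<in> P"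
  using assms baseD(3) unfolding edge_point_def by blast+

lemma edge_point_commute: "edge_point B i j p \<longleftrightarrow> edge_point B j i p"
  unfolding edge_point_def by (auto simp: insert_commute)

lemma edge_point_notin_span_Diff:
  assumes "edge_point B i j p"
  shows "p \<notin> cl (B - {i})"
proof
  note ij = edge_pointD[OF assms]
  assume "p \<in> cl (B - {i})"
  then have "{p, j} \<subseteq> cl (B - {i})" using ij(3,4) span_superset[of "B - {i}" P L] by blast
  moreover have "i \<in> cl {p, j}" using ij(7,8,5,6) by (rule span_pair_exchange)
  ultimately have "i \<in> cl (B - {i})" using span_subset_span by blast
  then show False using indepD(3)[OF baseD(1)[OF ij(1)] ij(2)] by simp
qed

lemma mem_if_edge_point_in_span:
  assumes "edge_point B i j p" "X \<subseteq> B" "p \<in> cl X"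
  shows "i \<in> X"
proof (rule ccontr)
  assume "i \<notin> X"
  then have "cl X \<subseteq> cl (B - {i})" using assms(2) by (intro span_mono) blast
  then show False using edge_point_notin_span_Diff[OF assms(1)] assms(3) by blast
qed

lemma base_replace_edge_point:
  assumes "edge_point B i j p"
  shows "base (insert p (B - {i}))"
proof (rule base_replace)
  note ij = edge_pointD[OF assms]
  show "p \<in> P" using ij(5,7,8) span_subset_carrier[of "{i, j}"] by blast
  show "p \<notin> cl (B - {i})" using assms by (rule edge_point_notin_span_Diff)
  show "base B" "i \<in> B" using ij(1,2) .
qed

lemma span_nset_replace_edge_point:
  assumes "edge_point B i j p" and X: "X \<in> [B]\<^bsup>m\<^esup>" "X \<notin> separating B m i j"
  shows "cl X \<in> spans m (insert p (B - {i}))"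
proof (cases "i \<in> X")
  case True
  note ij = edge_pointD[OF assms(1)]
  have "j \<in> X" using True X unfolding separating_def by blast
  then have "cl (insert p (X - {i})) = cl X"
    using span_replace_on_line[OF ij(7,8,5,6) True] ij(4) by blast
  moreover have "insert p (X - {i}) \<in> [insert p (B - {i})]\<^bsup>m\<^esup>"
  proof -
    have "p \<notin> B - {i}" using edge_point_notin_span_Diff[OF assms(1)] span_base by metis
    then have "p \<notin> X - {i}" using X(1) unfolding nsets_def by blast
    then have "card (insert p (X - {i})) = card X"
      using card_Suc_Diff1[of X i] X(1) True unfolding nsets_def by simp
    then show ?thesis using X(1) unfolding nsets_def by auto
  qed
  ultimately show ?thesis by (metis imageI)
next
  case False
  then have "X \<in> [insert p (B - {i})]\<^bsup>m\<^esup>" using X(1) unfolding nsets_def by blast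
  then show ?thesis by (rule imageI)
qed

end

section \<open>Projective spaces\<close>

locale projective_geometry =
  fixes P :: "'a set" and L :: "'a set set"
  assumes projective_space: "projective_space P L"
begin

sublocale linear_geometry P L
  using projective_space unfolding projective_space_def by unfold_locales simp

lemma plane_lines_meet:
  assumes "x \<in> P" "y \<in> P" "z \<in> P" "x \<noteq> y" "z \<notin> cl {x, y}"
    and "l \<in> L" "m \<in> L" "l \<subseteq> cl {x, y, z}" "m \<subseteq> cl {x, y, z}"
  obtains p where "p \<in> l" "p \<in> m"
proof -
  have "l \<inter> m \<noteq> {}"
    using has_dim_plane[OF assms(1-5)] assms(6-9) projective_space
    unfolding projective_space_def by simp
  then show ?thesis using that by blast
qed

lemma line_third_point:
  assumes xy: "x \<in> P" "y \<in> P" "x \<noteq> y"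
  obtains p where "p \<in> cl {x, y}" "p \<noteq> x" "p \<noteq> y"
proof -
  have line: "cl {x, y} \<in> L" using span_pair_line[OF xy] .
  obtain z where z: "z \<in> P" "z \<notin> cl {x, y}" using line_subset[OF line] by blast
  then have "has_dim P L (cl {x, y, z}) 2" using has_dim_plane xy by blast
  moreover have "cl {x, y} \<subseteq> cl {x, y, z}" by (rule span_mono) blast
  ultimately have "\<exists>a b c. {a, b, c} \<subseteq> cl {x, y} \<and> a \<noteq> b \<and> a \<noteq> c \<and> b \<noteq> c"
    using projective_space line unfolding projective_space_def by simp
  then show ?thesis using that by (metis insert_subset)
qed

lemma span_triple_project:
  assumes P: "x \<in> P" "a \<in> P" "b \<in> P" and w: "w \<in> cl {x, a, b}"
  obtains h where "h \<in> cl {a, b}" "w \<in> cl {x, h}"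
proof -
  let ?E = "cl {x, a, b}"
  have E: "subspace P L ?E" "?E \<subseteq> P" "x \<in> ?E" "a \<in> ?E" "b \<in> ?E"
    using P subspace_span[of "{x, a, b}"] span_subset_carrier[of "{x, a, b}"]
    by (auto intro: span_base)
  consider "x \<in> cl {a, b}" | "a = b" | "w = x" | "x \<notin> cl {a, b}" "a \<noteq> b" "w \<noteq> x" by blast
  then show ?thesis
  proof cases
    case 1
    then have "?E \<subseteq> cl {a, b}" by (intro span_subset_span) (simp add: span_base)
    then show ?thesis using that[of w] w by (auto intro: span_base)
  next
    case 2
    then show ?thesis using that[of a] w by (simp add: span_base)
  next
    case 3
    then show ?thesis using that[of a] by (simp add: span_base)
  next
    case 4
    then have "x \<noteq> a" by (auto intro: span_base)
    have "b \<notin> cl {x, a}"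
      using span_pair_exchange[OF P(1,2), of b] 4(1,2) by (auto simp: insert_commute)
    moreover have lines: "cl {x, w} \<in> L" "cl {a, b} \<in> L"
      using span_pair_line P w E(2) 4(2,3) by blast+
    moreover have "cl {x, w} \<subseteq> ?E" "cl {a, b} \<subseteq> ?E"
      using E w by (intro span_minimal; simp)+
    ultimately obtain h where h: "h \<in> cl {x, w}" "h \<in> cl {a, b}"
      using plane_lines_meet P \<open>x \<noteq> a\<close> by metis
    then have "cl {x, h} = cl {x, w}"
      using 4(1) lines(1) span_pair_eq_line span_base by (metis insertI1)
    then show ?thesis using that[of h] h(2) by (simp add: span_base)
  qed
qed

lemma span_insert_subspace:
  assumes S: "subspace P L S" "S \<noteq> {}" and x: "x \<in> P"
  shows "cl (insert x S) = (\<Union>h\<in>S. cl {x, h})"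
proof
  let ?T = "\<Union>h\<in>S. cl {x, h}"
  have SP: "S \<subseteq> P" using S(1) by (rule subspace_subset)
  have "cl {y, z} \<subseteq> ?T" if yz: "y \<in> ?T" "z \<in> ?T" for y z
  proof
    fix w assume "w \<in> cl {y, z}"
    obtain a b where a: "a \<in> S" "y \<in> cl {x, a}" and b: "b \<in> S" "z \<in> cl {x, b}"
      using yz by blast
    have "cl {x, a} \<subseteq> cl {x, a, b}" "cl {x, b} \<subseteq> cl {x, a, b}" by (auto intro!: span_mono)
    then have "cl {y, z} \<subseteq> cl {x, a, b}" using a(2) b(2) by (intro span_subset_span) blast
    then obtain h where h: "h \<in> cl {a, b}" "w \<in> cl {x, h}"
      using span_triple_project[OF x, of a b w] a(1) b(1) SP \<open>w \<in> cl {y, z}\<close> by blast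
    have "cl {a, b} \<subseteq> S" using a(1) b(1) S(1) by (intro span_minimal) auto
    then show "w \<in> ?T" using h by blast
  qed
  moreover have "?T \<subseteq> P" using span_subset_carrier[of "{x, _}"] x SP by blast
  ultimately have "subspace P L ?T" by (intro subspaceI_span_pair)
  moreover have "insert x S \<subseteq> ?T" using S(2) span_superset[of "{x, _}" P L] by blast
  ultimately show "cl (insert x S) \<subseteq> ?T" by (intro span_minimal)
  show "?T \<subseteq> cl (insert x S)" by (intro UN_least span_mono) blast
qed

sublocale exchange_geometry P L
proof
  fix A x y
  assume A: "finite A" "A \<subseteq> P" and x: "x \<in> P" and y: "y \<in> cl (insert x A)" "y \<notin> cl A"
  show "x \<in> cl (insert y A)"
  proof (cases "A = {}")
    case True
    then show ?thesis using y x span_singleton by simp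
  next
    case False
    then have "subspace P L (cl A)" "cl A \<noteq> {}"
      using subspace_span[OF A(2)] span_superset[of A P L] by auto
    moreover have "y \<in> cl (insert x (cl A))" using y(1) by (simp add: span_insert_span)
    ultimately obtain h where h: "h \<in> cl A" "y \<in> cl {x, h}"
      using span_insert_subspace x by blast
    then have "x \<in> cl {y, h}"
      using span_pair_exchange[OF x, of h y] y(2) span_subset_carrier[OF A(2)] by blast
    moreover have "{y, h} \<subseteq> cl (insert y A)"
      using h(1) span_mono[of A "insert y A" P L] span_base[of y "insert y A"] by blast
    ultimately show ?thesis using span_subset_span by blast
  qed
qed

end

section \<open>The dual of a projective space\<close>

locale projective_geometry_of_dim =
  fixes P :: "'a set" and L :: "'a set set" and n :: nat
  assumes proj_space_dim: "proj_space_dim P L n" and two_le_dim: "2 \<le> n"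
begin

sublocale projective_geometry P L
  using proj_space_dim unfolding proj_space_dim_def by unfold_locales simp

sublocale exchange_geometry_of_dim P L n
  using proj_space_dim unfolding proj_space_dim_def by unfold_locales simp

abbreviation hyperplanes :: "'a set set" where
  "hyperplanes \<equiv> dual_points P L n"

abbreviation dual_cl :: "'a set set \<Rightarrow> 'a set set" where
  "dual_cl \<equiv> span hyperplanes (dual_lines P L n)"

definition star :: "'a set \<Rightarrow> 'a set set" where
  "star M = {H \<in> hyperplanes. M \<subseteq> H}"

lemma mem_star_iff: "H \<in> star M \<longleftrightarrow> H \<in> hyperplanes \<and> M \<subseteq> H"
  unfolding star_def by simp

lemma dual_lines_eq_star: "dual_lines P L n = star ` Gr P L (n - 2)"
  unfolding dual_lines_def star_def dual_points_def by blast

lemma hyperplane_subspace: "H \<in> hyperplanes \<Longrightarrow> subspace P L H"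
  unfolding dual_points_def by (rule Gr_subspace)

lemma hyperplane_subset: "H \<in> hyperplanes \<Longrightarrow> H \<subseteq> P"
  by (simp add: hyperplane_subspace subspace_subset)

lemma hyperplane_eqI: "H \<in> hyperplanes \<Longrightarrow> H' \<in> hyperplanes \<Longrightarrow> H \<subseteq> H' \<Longrightarrow> H = H'"
  unfolding dual_points_def by (rule Gr_subset_eq)

lemma hyperplane_neq_carrier:
  assumes "H \<in> hyperplanes"
  shows "H \<noteq> P"
proof -
  obtain I where "indep I" "card I = n" "cl I = H"
    using assms two_le_dim unfolding dual_points_def Gr_iff by auto
  then show ?thesis using base_card[of I] unfolding base_def by auto
qed

lemma facet_in_hyperplanes:
  assumes "base B" "b \<in> B"
  shows "facet B b \<in> hyperplanes"
proof -
  have "indep (B - {b})" using indep_mono baseD(1)[OF assms(1)] by blast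
  moreover have "card (B - {b}) = Suc (n - 1)"
    using base_card[OF assms(1)] baseD(4)[OF assms(1)] assms(2) two_le_dim by simp
  ultimately show ?thesis unfolding facet_def dual_points_def Gr_iff by blast
qed

lemma span_insert_hyperplane:
  assumes "H \<in> hyperplanes" "x \<in> P" "x \<notin> H"
  shows "cl (insert x H) = P"
proof -
  have "cl (insert x H) \<in> Gr P L n"
    using Gr_insert[of H "n - 1" x] assms two_le_dim unfolding dual_points_def by simp
  moreover have "cl (insert x H) \<subseteq> P"
    using assms(2) hyperplane_subset[OF assms(1)] by (intro span_subset_carrier) blast
  ultimately show ?thesis using Gr_subset_eq carrier_in_Gr by blast
qed

lemma span_insert_section:
  assumes T: "subspace P L T" and H: "H \<in> hyperplanes" and x: "x \<in> T" "x \<notin> H"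
  shows "cl (insert x (T \<inter> H)) = T"
proof
  show "cl (insert x (T \<inter> H)) \<subseteq> T" using x(1) T by (intro span_minimal) auto
  show "T \<subseteq> cl (insert x (T \<inter> H))"
  proof
    fix y assume y: "y \<in> T"
    have P: "x \<in> P" "y \<in> P" using x y subspace_subset[OF T] by auto
    have "H \<noteq> {}" using H Gr_nonempty unfolding dual_points_def by blast
    moreover have "y \<in> cl (insert x H)" using span_insert_hyperplane[OF H P(1) x(2)] P(2) by simp
    ultimately obtain h where h: "h \<in> H" "y \<in> cl {x, h}"
      using span_insert_subspace[OF hyperplane_subspace[OF H]] P(1) by blast
    show "y \<in> cl (insert x (T \<inter> H))"
    proof (cases "y = x")
      case True
      then show ?thesis by (simp add: span_base)
    next
      case False
      have "h \<in> cl {y, x}"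
        using span_pair_exchange[of h x y] False h hyperplane_subset[OF H] P(1)
        by (auto simp: insert_commute)
      moreover have "cl {y, x} \<subseteq> T" using x(1) y T by (intro span_minimal) auto
      ultimately have "{x, h} \<subseteq> insert x (T \<inter> H)" using h(1) by blast
      then show ?thesis using h(2) span_mono by blast
    qed
  qed
qed

lemma section_swap:
  assumes T: "subspace P L T" "\<not> T \<subseteq> H'" and H: "H \<in> hyperplanes" "H' \<in> hyperplanes"
    and "T \<inter> H \<subseteq> H'"
  shows "T \<inter> H' \<subseteq> H"
proof (rule subsetI, rule ccontr)
  fix y assume y: "y \<in> T \<inter> H'" "y \<notin> H"
  then have "T = cl (insert y (T \<inter> H))" using span_insert_section T(1) H(1) by blast
  also have "\<dots> \<subseteq> H'" using y(1) assms(5) hyperplane_subspace[OF H(2)] by (intro span_minimal) auto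
  finally show False using T(2) by simp
qed

lemma Gr_section:
  assumes S: "S \<in> Gr P L (Suc k)" and H: "H \<in> hyperplanes" and "\<not> S \<subseteq> H"
  shows "S \<inter> H \<in> Gr P L k"
proof -
  obtain x where x: "x \<in> S" "x \<notin> H" using assms(3) by blast
  have sub: "subspace P L S" using S by (rule Gr_subspace)
  have "subspace P L (S \<inter> H)" using sub hyperplane_subspace[OF H] by (rule subspace_Int)
  then have "cl (S \<inter> H) = S \<inter> H" "S \<inter> H \<subseteq> P" by (simp_all add: span_eq_self subspace_subset)
  then obtain J where J: "J \<subseteq> S \<inter> H" "indep J" "cl J = S \<inter> H"
    using indep_spanning_subset[of "S \<inter> H"] by metis
  obtain K where K: "indep K" "card K = Suc (Suc k)" "cl K = S" using S Gr_iff by blast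
  have "x \<notin> J" "x \<in> P" using x J(1) subspace_subset[OF sub] by auto
  then have ind: "indep (insert x J)" using indep_insert_iff J x(2) by simp
  have "cl (insert x J) = S"
    using span_insert_section[OF sub H x] J(3) span_insert_span by metis
  then have "card (insert x J) = Suc (Suc k)" using indep_card_eq[OF ind K(1)] K(2,3) by simp
  then have "card J = Suc k" using \<open>x \<notin> J\<close> indepD(2)[OF J(2)] by simp
  then show ?thesis using J Gr_iff by blast
qed

lemma hyperplane_Int:
  assumes "H \<in> hyperplanes" "H' \<in> hyperplanes" "H \<noteq> H'"
  shows "H \<inter> H' \<in> Gr P L (n - 2)"
proof (rule Gr_section)
  have "Suc (n - 2) = n - 1" using two_le_dim by simp
  then show "H \<in> Gr P L (Suc (n - 2))" using assms(1) unfolding dual_points_def by simp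
  show "\<not> H \<subseteq> H'" using assms hyperplane_eqI by blast
qed (rule assms(2))

lemma Gr_eq_Int_if_star:
  assumes "T \<in> Gr P L (n - 2)" "H \<in> star T" "H' \<in> star T" "H \<noteq> H'"
  shows "T = H \<inter> H'"
  using Gr_subset_eq[OF assms(1) hyperplane_Int] assms unfolding mem_star_iff by blast

lemma star_proper_two_points:
  assumes "T \<in> Gr P L (n - 2)"
  shows "star T \<subset> hyperplanes" "\<exists>H H'. H \<noteq> H' \<and> H \<in> star T \<and> H' \<in> star T"
proof -
  obtain I where I: "indep I" "card I = Suc (n - 2)" "cl I = T" using assms Gr_iff by blast
  obtain B where B: "I \<subseteq> B" "base B" using base_extending[OF I(1)] .
  have star: "facet B b \<in> star T \<longleftrightarrow> b \<notin> I" if "b \<in> B" for b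
  proof -
    have "T \<subseteq> facet B b" if "b \<notin> I"
      using that B(1) I(3) unfolding facet_def by (auto intro!: span_mono)
    moreover have "b \<notin> facet B b"
      unfolding facet_def using indepD(3) baseD(1)[OF B(2)] that by blast
    moreover have "b \<in> T" if "b \<in> I" using that I(3) span_base by metis
    ultimately show ?thesis using facet_in_hyperplanes[OF B(2) that] unfolding mem_star_iff by blast
  qed
  obtain b where "b \<in> I" using I(2) by fastforce
  then have "facet B b \<in> hyperplanes - star T" using star B facet_in_hyperplanes by blast
  then show "star T \<subset> hyperplanes" unfolding star_def by blast
  have "card (B - I) = 2"
    using base_card[OF B(2)] I two_le_dim by (simp add: card_Diff_subset B(1) indepD(2))
  then obtain b c where "b \<noteq> c" "{b, c} \<subseteq> B - I" by (metis card_2_iff order_refl)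
  then show "\<exists>H H'. H \<noteq> H' \<and> H \<in> star T \<and> H' \<in> star T"
    using star inj_onD[OF inj_on_facet[OF baseD(1)[OF B(2)]], of b c] by blast
qed

lemma linear_space_dual: "linear_space hyperplanes (dual_lines P L n)"
  unfolding linear_space_def dual_lines_eq_star
proof (intro conjI ballI impI)
  fix l assume "l \<in> star ` Gr P L (n - 2)"
  then obtain T where "T \<in> Gr P L (n - 2)" "l = star T" by blast
  then show "l \<subset> hyperplanes" "\<exists>p q. p \<noteq> q \<and> p \<in> l \<and> q \<in> l"
    using star_proper_two_points by simp_all
next
  fix H H' assume H: "H \<in> hyperplanes" "H' \<in> hyperplanes" "H \<noteq> H'"
  show "\<exists>!l. l \<in> star ` Gr P L (n - 2) \<and> H \<in> l \<and> H' \<in> l"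
  proof (rule ex1I)
    show "star (H \<inter> H') \<in> star ` Gr P L (n - 2) \<and> H \<in> star (H \<inter> H') \<and> H' \<in> star (H \<inter> H')"
      using hyperplane_Int H by (simp add: mem_star_iff)
    show "l = star (H \<inter> H')" if "l \<in> star ` Gr P L (n - 2) \<and> H \<in> l \<and> H' \<in> l" for l
      using that Gr_eq_Int_if_star H(3) by blast
  qed
qed

sublocale dual: linear_geometry hyperplanes "dual_lines P L n"
  using linear_space_dual by unfold_locales

lemma dual_subspace_star: "subspace hyperplanes (dual_lines P L n) (star M)"
  unfolding subspace_def dual_lines_eq_star
proof (intro conjI ballI allI impI)
  fix l H H'
  assume "l \<in> star ` Gr P L (n - 2)" and H: "H \<in> star M" "H' \<in> star M" "H \<noteq> H'" "H \<in> l" "H' \<in> l"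
  then have "l = star (H \<inter> H')" using Gr_eq_Int_if_star by blast
  then show "l \<subseteq> star M" using H unfolding star_def by blast
qed (simp add: star_def)

lemma hyperplane_through_section:
  assumes T: "subspace P L T" "\<not> T \<subseteq> H" and H: "H \<in> hyperplanes" "K \<in> hyperplanes" "H \<noteq> K"
    and "T \<inter> K \<subseteq> H"
  obtains M where "M \<in> star T" "M \<noteq> K" "H \<inter> K \<subseteq> M"
proof -
  obtain x where x: "x \<in> T" "x \<notin> H" using T(2) by blast
  then have "x \<in> P" using subspace_subset[OF T(1)] by blast
  define M where "M = cl (insert x (H \<inter> K))"
  have "M \<in> Gr P L (Suc (n - 2))"
    unfolding M_def using Gr_insert hyperplane_Int H \<open>x \<in> P\<close> x(2) by blast
  moreover have "Suc (n - 2) = n - 1" using two_le_dim by simp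
  ultimately have "M \<in> hyperplanes" unfolding dual_points_def by simp
  moreover have "T \<inter> H \<subseteq> K" using section_swap T H(1,2) assms(6) by blast
  then have "cl (insert x (T \<inter> H)) \<subseteq> M" unfolding M_def by (intro span_mono) blast
  then have "T \<subseteq> M" using span_insert_section T(1) H(1) x by blast
  moreover have "insert x (H \<inter> K) \<subseteq> M" unfolding M_def by (rule span_superset)
  moreover have "x \<notin> K" using x assms(6) by blast
  ultimately show ?thesis using that unfolding mem_star_iff by blast
qed

lemma dual_span_insert_star:
  assumes T: "subspace P L T" and K: "K \<in> hyperplanes"
  shows "dual_cl (insert K (star T)) = star (T \<inter> K)"
proof
  have "insert K (star T) \<subseteq> star (T \<inter> K)" using K unfolding star_def by blast
  then show "dual_cl (insert K (star T)) \<subseteq> star (T \<inter> K)"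
    using dual_subspace_star by (rule span_minimal)
  show "star (T \<inter> K) \<subseteq> dual_cl (insert K (star T))"
  proof
    fix H assume "H \<in> star (T \<inter> K)"
    then have H: "H \<in> hyperplanes" "T \<inter> K \<subseteq> H" by (simp_all add: mem_star_iff)
    show "H \<in> dual_cl (insert K (star T))"
    proof (cases "T \<subseteq> H \<or> H = K")
      case True
      then show ?thesis using H(1) by (intro span_base) (auto simp: mem_star_iff)
    next
      case False
      then have "\<not> T \<subseteq> H" "H \<noteq> K" by auto
      then obtain M where M: "M \<in> star T" "M \<noteq> K" "H \<inter> K \<subseteq> M"
        using hyperplane_through_section[OF T _ H(1) K _ H(2)] by metis
      have "star (H \<inter> K) \<in> dual_lines P L n"
        using hyperplane_Int H(1) K False unfolding dual_lines_eq_star by blast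
      then have "dual_cl {K, M} = star (H \<inter> K)"
        using M K by (intro dual.span_pair_eq_line) (auto simp: mem_star_iff)
      then have "H \<in> dual_cl {K, M}" using H(1) by (simp add: mem_star_iff)
      moreover have "dual_cl {K, M} \<subseteq> dual_cl (insert K (star T))"
        using M(1) by (intro span_mono) blast
      ultimately show ?thesis by blast
    qed
  qed
qed

lemma dual_span_eq_star:
  assumes "finite X" "X \<subseteq> hyperplanes"
  shows "dual_cl X = star (P \<inter> \<Inter>X)"
  using assms
proof (induction X rule: finite_induct)
  case empty
  have "star P = {}" using hyperplane_subset hyperplane_neq_carrier unfolding star_def by blast
  then show ?case by (simp add: dual.span_empty)
next
  case (insert K X)
  have "subspace P L (P \<inter> \<Inter>X)"
    using insert.prems hyperplane_subspace by (intro subspace_Inter) blast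
  then have "dual_cl (insert K (star (P \<inter> \<Inter>X))) = star (P \<inter> \<Inter>X \<inter> K)"
    using insert.prems by (intro dual_span_insert_star) auto
  moreover have "P \<inter> \<Inter>X \<inter> K = P \<inter> \<Inter>(insert K X)" by blast
  ultimately show ?case
    using insert.IH insert.prems span_insert_span[of hyperplanes "dual_lines P L n" K X] by simp
qed

sublocale dual: exchange_geometry hyperplanes "dual_lines P L n"
proof
  fix A H K
  assume A: "finite A" "A \<subseteq> hyperplanes" and H: "H \<in> hyperplanes"
    and K: "K \<in> dual_cl (insert H A)" "K \<notin> dual_cl A"
  let ?M = "P \<inter> \<Inter>A"
  have M: "subspace P L ?M" using A(2) hyperplane_subspace by (intro subspace_Inter) blast
  have KH: "K \<in> hyperplanes" "?M \<inter> H \<subseteq> K"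
    using K(1) dual_span_eq_star[of "insert H A"] A H by (auto simp: mem_star_iff)
  have "\<not> ?M \<subseteq> K" using K(2) KH(1) dual_span_eq_star[OF A] by (simp add: mem_star_iff)
  then have "?M \<inter> K \<subseteq> H" using section_swap[OF M] H KH by blast
  then show "H \<in> dual_cl (insert K A)"
    using dual_span_eq_star[of "insert K A"] A H KH(1) by (auto simp: mem_star_iff)
qed

lemma dual_span_facets:
  assumes "base B" "Y \<subseteq> B"
  shows "dual_cl (facet B ` Y) = star (cl (B - Y))"
proof -
  have "finite Y" using assms baseD(4) finite_subset by blast
  moreover have "facet B ` Y \<subseteq> hyperplanes" using facet_in_hyperplanes assms by blast
  ultimately show ?thesis
    using dual_span_eq_star[of "facet B ` Y"] span_Diff_eq_Inter_facets[OF assms] by simp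
qed

lemma dual_base_facets:
  assumes B: "base B"
  shows "dual.base (facet B ` B)"
  unfolding dual.base_def dual.indep_def
proof (intro conjI ballI)
  show "facet B ` B \<subseteq> hyperplanes" "finite (facet B ` B)"
    using facet_in_hyperplanes[OF B] baseD(4)[OF B] by auto
  show "dual_cl (facet B ` B) = hyperplanes"
    using dual_span_facets[OF B order_refl] by (simp add: span_empty star_def)
  fix K assume "K \<in> facet B ` B"
  then obtain b where b: "b \<in> B" "K = facet B b" by blast
  then have "facet B ` B - {K} = facet B ` (B - {b})"
    using inj_on_image_set_diff[OF inj_on_facet[OF baseD(1)[OF B]], of B "{b}"] by simp
  moreover have "B - (B - {b}) = {b}" "cl {b} = {b}"
    using b(1) baseD(3)[OF B] span_singleton by auto
  ultimately have "dual_cl (facet B ` B - {K}) = star {b}"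
    using dual_span_facets[OF B, of "B - {b}"] by simp
  moreover have "b \<notin> K"
    using indepD(3)[OF baseD(1)[OF B] b(1)] b(2) unfolding facet_def by simp
  ultimately show "K \<notin> dual_cl (facet B ` B - {K})" by (simp add: mem_star_iff)
qed

sublocale dual: exchange_geometry_of_dim hyperplanes "dual_lines P L n" n
proof
  obtain B where B: "base B" using base_extending[OF indep_empty] .
  have "card (facet B ` B) = Suc n"
    using card_image[OF inj_on_facet[OF baseD(1)[OF B]]] base_card[OF B] by simp
  then have "hyperplanes \<in> Gr hyperplanes (dual_lines P L n) n"
    using dual.baseD(1,2)[OF dual_base_facets[OF B]] dual.Gr_iff by blast
  then show "has_dim hyperplanes (dual_lines P L n) hyperplanes n" unfolding Gr_def by simp
qed

end

section \<open>Maps induced on bases\<close>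

locale exchange_geometry_pair =
  src: exchange_geometry_of_dim P L n + tgt: exchange_geometry_of_dim P' L' n
  for P :: "'a set" and L :: "'a set set" and P' :: "'b set" and L' :: "'b set set" and n :: nat +
  fixes k :: nat and f :: "'a set \<Rightarrow> 'b set"
  assumes k_bounds: "0 < k" "Suc k < n"
begin

definition induces :: "('a \<Rightarrow> 'b) \<Rightarrow> 'a set \<Rightarrow> bool" where
  "induces \<tau> B \<longleftrightarrow> inj_on \<tau> B \<and> tgt.base (\<tau> ` B) \<and>
     (\<forall>X\<in>[B]\<^bsup>Suc k\<^esup>. f (src.cl X) = tgt.cl (\<tau> ` X))"

definition coinduces :: "('a \<Rightarrow> 'b) \<Rightarrow> 'a set \<Rightarrow> bool" where
  "coinduces \<tau> B \<longleftrightarrow> inj_on \<tau> B \<and> tgt.base (\<tau> ` B) \<and>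
     (\<forall>X\<in>[B]\<^bsup>Suc k\<^esup>. f (src.cl X) = tgt.cl (\<tau> ` (B - X)))"

lemma inducesD:
  assumes "induces \<tau> B"
  shows "inj_on \<tau> B" "tgt.base (\<tau> ` B)" "\<And>X. X \<in> [B]\<^bsup>Suc k\<^esup> \<Longrightarrow> f (src.cl X) = tgt.cl (\<tau> ` X)"
  using assms unfolding induces_def by simp_all

lemma coinducesD:
  assumes "coinduces \<tau> B"
  shows "inj_on \<tau> B" "tgt.base (\<tau> ` B)"
    "\<And>X. X \<in> [B]\<^bsup>Suc k\<^esup> \<Longrightarrow> f (src.cl X) = tgt.cl (\<tau> ` (B - X))"
  using assms unfolding coinduces_def by simp_all

lemma induces_cong:
  assumes "\<And>p. p \<in> B \<Longrightarrow> \<sigma> p = \<tau> p"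
  shows "induces \<sigma> B \<longleftrightarrow> induces \<tau> B"
proof -
  have "\<sigma> ` X = \<tau> ` X" if "X \<subseteq> B" for X using assms that by (intro image_cong) auto
  then show ?thesis
    unfolding induces_def nsets_def using inj_on_cong[of B \<sigma> \<tau>] assms by simp
qed

lemma mem_span_image_if_induces:
  assumes \<tau>: "induces \<tau> B" and A: "A \<subseteq> B" "Suc k < card A" and Z: "Z \<subseteq> A" "card Z \<le> Suc k"
    and z: "\<And>X. \<lbrakk>X \<in> [A]\<^bsup>Suc k\<^esup>; Z \<subseteq> X\<rbrakk> \<Longrightarrow> z \<in> f (src.cl X)"
  shows "z \<in> tgt.cl (\<tau> ` Z)"
proof -
  let ?\<X> = "{X \<in> [A]\<^bsup>Suc k\<^esup>. Z \<subseteq> X}"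
  have "finite A" using A(2) card_ge_0_finite by force
  obtain W where "W \<in> [A]\<^bsup>Suc k\<^esup>" "Z \<subseteq> W"
    using nset_between[of A Z "{}" "Suc k"] \<open>finite A\<close> A(2) Z by auto
  then have W: "W \<in> ?\<X>" by blast
  have sub: "X \<in> [B]\<^bsup>Suc k\<^esup>" "X \<subseteq> B" if "X \<in> ?\<X>" for X
    using that nsets_mono[OF A(1)] A(1) unfolding nsets_def by blast+
  have "z \<in> tgt.cl (\<Inter>((`) \<tau> ` ?\<X>))"
  proof (rule tgt.mem_span_Inter)
    show "tgt.indep (\<tau> ` B)" using inducesD(2)[OF \<tau>] by (rule tgt.baseD)
    show "(`) \<tau> ` ?\<X> \<noteq> {}" using W by blast
    show "Y \<subseteq> \<tau> ` B \<and> z \<in> tgt.cl Y" if "Y \<in> (`) \<tau> ` ?\<X>" for Y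
      using that sub inducesD(3)[OF \<tau>] z by auto
  qed
  moreover have "\<tau> ` (\<Inter>X\<in>?\<X>. X) = (\<Inter>X\<in>?\<X>. \<tau> ` X)"
    using inducesD(1)[OF \<tau>] _ W by (rule image_INT) (use sub(2) in blast)
  ultimately show ?thesis
    using Inter_nsets_containing[OF \<open>finite A\<close> Z A(2)] by simp
qed

lemma induces_agree:
  assumes \<tau>: "induces \<tau> B" and \<upsilon>: "induces \<upsilon> B'" and A: "Suc k < card (B \<inter> B')"
    and p: "p \<in> B \<inter> B'"
  shows "\<tau> p = \<upsilon> p"
proof -
  have "\<upsilon> p \<in> f (src.cl X)" if X: "X \<in> [B \<inter> B']\<^bsup>Suc k\<^esup>" "{p} \<subseteq> X" for X
  proof -
    have "X \<in> [B']\<^bsup>Suc k\<^esup>" using X(1) nsets_mono[of "B \<inter> B'" B'] by blast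
    then show ?thesis using inducesD(3)[OF \<upsilon>] X(2) by (simp add: span_base)
  qed
  then have "\<upsilon> p \<in> tgt.cl (\<tau> ` {p})"
    using mem_span_image_if_induces[OF \<tau> _ A, of "{p}" "\<upsilon> p"] p by simp
  moreover have "\<tau> p \<in> P'" using tgt.baseD(3)[OF inducesD(2)[OF \<tau>]] p by blast
  ultimately show ?thesis using tgt.span_singleton by simp
qed

lemma subset_if_induces_coinduces:
  assumes \<tau>: "induces \<tau> B" and \<upsilon>: "coinduces \<upsilon> B'" and A: "Suc k < card (B \<inter> B')"
  shows "B' \<subseteq> B"
proof (rule subsetI, rule ccontr)
  fix y assume y: "y \<in> B'" "y \<notin> B"
  have "\<upsilon> y \<in> f (src.cl X)" if X: "X \<in> [B \<inter> B']\<^bsup>Suc k\<^esup>" for X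
  proof -
    have "X \<in> [B']\<^bsup>Suc k\<^esup>" using X nsets_mono[of "B \<inter> B'" B'] by blast
    moreover have "y \<notin> X" using X y(2) unfolding nsets_def by blast
    ultimately show ?thesis using coinducesD(3)[OF \<upsilon>] y(1) by (simp add: span_base)
  qed
  then have "\<upsilon> y \<in> tgt.cl (\<tau> ` {})"
    using mem_span_image_if_induces[OF \<tau> _ A, of "{}" "\<upsilon> y"] by simp
  then show False by (simp add: tgt.span_empty)
qed

lemma induces_all_or_coinduces_all:
  assumes "\<And>B. src.base B \<Longrightarrow> (\<exists>\<tau>. induces \<tau> B) \<or> (\<exists>\<tau>. coinduces \<tau> B)"
  shows "(\<forall>B. src.base B \<longrightarrow> (\<exists>\<tau>. induces \<tau> B)) \<or> (\<forall>B. src.base B \<longrightarrow> (\<exists>\<tau>. coinduces \<tau> B))"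
proof (cases "\<exists>B \<tau>. src.base B \<and> induces \<tau> B")
  case True
  then obtain B where B: "src.base B" "\<exists>\<tau>. induces \<tau> B" by blast
  have "\<exists>\<tau>. induces \<tau> B'" if "src.base B'" for B'
  proof (rule src.base_exchange_induct[where K = "{}", OF B(1) that])
    fix C C' assume C: "src.base C" "src.base C'" "card (C \<inter> C') = n" "\<exists>\<tau>. induces \<tau> C"
    have "\<not> C' \<subseteq> C"
      using C(3) src.base_eqI[OF C(2,1)] src.base_card[OF C(2)] by auto
    then show "\<exists>\<tau>. induces \<tau> C'"
      using assms[OF C(2)] C(3,4) k_bounds(2) subset_if_induces_coinduces by metis
  qed (use B(2) in simp_all)
  then show ?thesis by blast
qed (use assms in blast)

lemma induces_agree_on_bases:
  assumes all: "\<And>B. src.base B \<Longrightarrow> \<exists>\<tau>. induces \<tau> B"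
    and B: "src.base B" "induces \<tau> B" "p \<in> B" and B': "src.base B'" "induces \<upsilon> B'" "p \<in> B'"
  shows "\<tau> p = \<upsilon> p"
proof -
  have "\<forall>\<upsilon>. induces \<upsilon> B' \<longrightarrow> \<tau> p = \<upsilon> p"
  proof (rule src.base_exchange_induct[where K = "{p}", OF B(1) B'(1)])
    show "\<forall>\<upsilon>. induces \<upsilon> B \<longrightarrow> \<tau> p = \<upsilon> p"
      using induces_agree[OF B(2), of _ B p] B(1,3) src.base_card k_bounds(2) by simp
    fix C C'
    assume C: "src.base C" "{p} \<subseteq> C \<inter> C'" "card (C \<inter> C') = n" "\<forall>\<upsilon>. induces \<upsilon> C \<longrightarrow> \<tau> p = \<upsilon> p"
    obtain \<phi> where \<phi>: "induces \<phi> C" using all[OF C(1)] by blast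
    show "\<forall>\<upsilon>. induces \<upsilon> C' \<longrightarrow> \<tau> p = \<upsilon> p"
      using induces_agree[OF \<phi>, of _ C' p] C(2-4) \<phi> k_bounds(2) by simp
  qed (use B(3) B'(3) in simp_all)
  then show ?thesis using B'(2) by blast
qed

lemma common_inducing_map:
  assumes all: "\<And>B. src.base B \<Longrightarrow> \<exists>\<tau>. induces \<tau> B"
  obtains g where "\<And>B. src.base B \<Longrightarrow> induces g B"
proof -
  define g where "g p = (SOME q. \<exists>B \<tau>. src.base B \<and> induces \<tau> B \<and> p \<in> B \<and> q = \<tau> p)" for p
  have "induces g B" if B: "src.base B" for B
  proof -
    obtain \<tau> where \<tau>: "induces \<tau> B" using all[OF B] by blast
    have "g p = \<tau> p" if p: "p \<in> B" for p
    proof -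
      have "\<exists>C \<upsilon>. src.base C \<and> induces \<upsilon> C \<and> p \<in> C \<and> g p = \<upsilon> p"
        unfolding g_def by (rule someI_ex) (use B \<tau> p in blast)
      then show ?thesis using induces_agree_on_bases[OF all] B \<tau> p by metis
    qed
    then show ?thesis using induces_cong[of B g \<tau>] \<tau> by blast
  qed
  then show ?thesis by (rule that)
qed

lemma strong_embeddingI:
  assumes inj: "inj_on g P" and gP: "g ` P \<subseteq> P'"
    and line: "\<And>x y z. \<lbrakk>x \<in> P; y \<in> P; z \<in> src.cl {x, y}\<rbrakk> \<Longrightarrow> g z \<in> tgt.cl {g x, g y}"
    and indep: "\<And>X. src.indep X \<Longrightarrow> tgt.indep (g ` X)"
  shows "strong_embedding P L P' L' g"
proof -
  have collinear: "collinear L' {g x, g y, g z} \<longleftrightarrow> collinear L {x, y, z}"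
    if P: "x \<in> P" "y \<in> P" "z \<in> P" for x y z
  proof -
    have P': "g x \<in> P'" "g y \<in> P'" "g z \<in> P'" using P gP by blast+
    have "g z \<notin> tgt.cl {g x, g y}" if xyz: "x \<noteq> y" "z \<notin> src.cl {x, y}"
    proof -
      have "z \<notin> {x, y}" using xyz(2) span_base by metis
      then have "src.indep {z, x, y}"
        using src.indep_insert_iff[of z "{x, y}"] src.indep_pair P xyz(2) by simp
      then have "tgt.indep (insert (g z) {g x, g y})" using indep[of "{z, x, y}"] by simp
      moreover have "g z \<notin> {g x, g y}" using \<open>z \<notin> {x, y}\<close> inj P by (auto dest: inj_onD)
      ultimately show ?thesis using tgt.indep_insert_iff[of "g z" "{g x, g y}"] by blast
    qed
    then have "g x = g y \<or> g z \<in> tgt.cl {g x, g y} \<longleftrightarrow> x = y \<or> z \<in> src.cl {x, y}"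
      using line P inj_onD[OF inj] by metis
    then show ?thesis
      using src.collinear_iff_span[OF src.lines_nonempty P]
        tgt.collinear_iff_span[OF tgt.lines_nonempty P'] k_bounds by simp
  qed
  then show ?thesis
    unfolding strong_embedding_def src.independent_iff_indep tgt.independent_iff_indep
    using inj gP indep by simp
qed

end

locale induced_map = exchange_geometry_pair +
  fixes g :: "'a \<Rightarrow> 'b"
  assumes induces: "src.base B \<Longrightarrow> induces g B"
begin

lemma inj_on_map: "inj_on g P"
proof (rule inj_onI)
  fix x y assume xy: "x \<in> P" "y \<in> P" "g x = g y"
  obtain B where B: "src.base B" "x \<in> B" "y \<in> B" using src.base_through_pair[OF xy(1,2)] .
  then show "x = y" using inj_onD[OF inducesD(1)[OF induces[OF B(1)]] xy(3)] by blast
qed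

lemma map_closed: "g ` P \<subseteq> P'"
proof
  fix b assume "b \<in> g ` P"
  then obtain x where x: "x \<in> P" "b = g x" by blast
  obtain B where B: "src.base B" "x \<in> B" using src.base_through_pair[OF x(1) x(1)] .
  then show "b \<in> P'" using tgt.baseD(3)[OF inducesD(2)[OF induces[OF B(1)]]] x(2) by blast
qed

lemma indep_image:
  assumes "src.indep X"
  shows "tgt.indep (g ` X)"
proof -
  obtain B where B: "X \<subseteq> B" "src.base B" using src.base_extending[OF assms] .
  have "tgt.indep (g ` B)" using tgt.baseD(1) inducesD(2) induces[OF B(2)] by metis
  then show ?thesis using image_mono[OF B(1)] by (rule tgt.indep_mono)
qed

lemma image_span_indep:
  assumes "src.indep X" "card X = Suc k"
  shows "f (src.cl X) = tgt.cl (g ` X)"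
proof -
  obtain B where "X \<subseteq> B" "src.base B" using src.base_extending[OF assms(1)] .
  then have "X \<in> [B]\<^bsup>Suc k\<^esup>" using assms src.indepD(2) unfolding nsets_def by simp
  then show ?thesis using inducesD(3)[OF induces[OF \<open>src.base B\<close>]] by simp
qed

lemma image_eq_span:
  assumes S: "S \<in> Gr P L k"
  shows "f S = tgt.cl (g ` S)"
proof (rule antisym)
  obtain I where I: "src.indep I" "card I = Suc k" "src.cl I = S" using S src.Gr_iff by blast
  then have fS: "f S = tgt.cl (g ` I)" using image_span_indep by blast
  have "I \<subseteq> S" using I(3) span_superset by metis
  then show "f S \<subseteq> tgt.cl (g ` S)" unfolding fS by (intro span_mono image_mono)
  have "g x \<in> f S" if x: "x \<in> S" for x
  proof -
    have "x \<in> P" using x src.subspace_subset[OF src.Gr_subspace[OF S]] by blast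
    then obtain J where J: "{x} \<subseteq> J" "src.indep J" "card J = Suc k" "src.cl J = S"
      using src.Gr_base_extending[OF S src.indep_singleton, of x] x by blast
    then have "f S = tgt.cl (g ` J)" using image_span_indep by blast
    then show ?thesis using J(1) by (simp add: span_base)
  qed
  then have "g ` S \<subseteq> f S" by blast
  then show "tgt.cl (g ` S) \<subseteq> f S" unfolding fS by (rule span_subset_span)
qed

lemma image_span_pair:
  assumes "x \<in> P" "y \<in> P" "z \<in> src.cl {x, y}"
  shows "g z \<in> tgt.cl {g x, g y}"
proof -
  obtain B where B: "src.base B" "x \<in> B" "y \<in> B" using src.base_through_pair[OF assms(1,2)] .
  have "g z \<in> f (src.cl X)" if X: "X \<in> [B]\<^bsup>Suc k\<^esup>" "{x, y} \<subseteq> X" for X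
  proof -
    have "src.indep X" "card X = Suc k"
      using X(1) src.indep_mono[OF src.baseD(1)[OF B(1)]] unfolding nsets_def by auto
    then have "src.cl X \<in> Gr P L k" using src.Gr_iff by blast
    moreover have "z \<in> src.cl X" using assms(3) span_mono[OF X(2)] by blast
    ultimately show ?thesis using image_eq_span by (simp add: span_base)
  qed
  moreover have "card {x, y} \<le> Suc k" using k_bounds(1) by (simp add: card_insert_if)
  moreover have "Suc k < card B" using src.base_card[OF B(1)] k_bounds(2) by simp
  ultimately have "g z \<in> tgt.cl (g ` {x, y})"
    using B by (intro mem_span_image_if_induces[OF induces[OF B(1)] order_refl]) simp_all
  then show ?thesis by simp
qed

lemma strong_embedding: "strong_embedding P L P' L' g"
  using inj_on_map map_closed image_span_pair indep_image by (rule strong_embeddingI)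

end

context exchange_geometry_pair
begin

lemma strong_embedding_if_induces:
  assumes "\<And>B. src.base B \<Longrightarrow> \<exists>\<tau>. induces \<tau> B"
  shows "\<exists>g. strong_embedding P L P' L' g \<and> (\<forall>S\<in>Gr P L k. f S = tgt.cl (g ` S))"
proof -
  obtain g where "\<And>B. src.base B \<Longrightarrow> induces g B" using common_inducing_map[OF assms] by blast
  then interpret induced_map P L P' L' n k f g by unfold_locales
  show ?thesis using strong_embedding image_eq_span by blast
qed

end

text \<open>The dual of the target turns coinduced maps into induced ones: in the dual base of facets,
  the star of the span of \<open>\<tau> ` (B - X)\<close> is spanned by the facets opposite to \<open>\<tau> ` X\<close>.\<close>

locale exchange_projective_pair =
  exchange_geometry_pair P L P' L' n k f + tgt: projective_geometry_of_dim P' L' n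
  for P :: "'a set" and L :: "'a set set" and P' :: "'b set" and L' :: "'b set set"
    and n k :: nat and f :: "'a set \<Rightarrow> 'b set"
begin

sublocale dual:
  exchange_geometry_pair P L tgt.hyperplanes "dual_lines P' L' n" n k "\<lambda>S. tgt.star (f S)"
  using k_bounds by unfold_locales

lemma dual_induces_if_coinduces:
  assumes "coinduces \<tau> B"
  shows "dual.induces (tgt.facet (\<tau> ` B) \<circ> \<tau>) B"
  unfolding dual.induces_def
proof (intro conjI ballI)
  note base = coinducesD(2)[OF assms]
  show "inj_on (tgt.facet (\<tau> ` B) \<circ> \<tau>) B"
    using coinducesD(1)[OF assms] tgt.inj_on_facet[OF tgt.baseD(1)[OF base]] by (rule comp_inj_on)
  show "tgt.dual.base ((tgt.facet (\<tau> ` B) \<circ> \<tau>) ` B)"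
    using tgt.dual_base_facets[OF base] by (simp add: image_comp)
  fix X assume X: "X \<in> [B]\<^bsup>Suc k\<^esup>"
  then have "X \<subseteq> B" unfolding nsets_def by simp
  then have "\<tau> ` (B - X) = \<tau> ` B - \<tau> ` X"
    using inj_on_image_set_diff[OF coinducesD(1)[OF assms]] by blast
  then show "tgt.star (f (src.cl X)) = tgt.dual_cl ((tgt.facet (\<tau> ` B) \<circ> \<tau>) ` X)"
    using tgt.dual_span_facets[OF base image_mono[OF \<open>X \<subseteq> B\<close>]] coinducesD(3)[OF assms X]
    by (simp add: image_comp)
qed

lemma dual_strong_embedding_if_coinduces:
  assumes "\<And>B. src.base B \<Longrightarrow> \<exists>\<tau>. coinduces \<tau> B"
  shows "\<exists>g. strong_embedding P L tgt.hyperplanes (dual_lines P' L' n) g \<and>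
    (\<forall>S\<in>Gr P L k. tgt.dual_cl (g ` S) = tgt.star (f S))"
  using dual.strong_embedding_if_induces dual_induces_if_coinduces assms by metis

end

section \<open>Maps preserving base subsets\<close>

locale base_subset_map = exchange_geometry_pair +
  assumes third_point: "\<lbrakk>x \<in> P; y \<in> P; x \<noteq> y\<rbrakk> \<Longrightarrow> \<exists>p\<in>src.cl {x, y}. p \<noteq> x \<and> p \<noteq> y"
    and base_subset_image: "is_base_subset P L k \<B> \<Longrightarrow> is_base_subset P' L' k (f ` \<B>)"
begin

lemma image_spans_base:
  assumes "src.base B"
  obtains B' where "tgt.base B'" "f ` src.spans (Suc k) B = tgt.spans (Suc k) B'"
proof -
  have "is_base_subset P L k (src.spans (Suc k) B)"
    unfolding is_base_subset_def using assms src.is_base_iff_base src.base_subset_of_eq by metis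
  then have "is_base_subset P' L' k (f ` src.spans (Suc k) B)" by (rule base_subset_image)
  then show ?thesis
    unfolding is_base_subset_def tgt.is_base_iff_base using tgt.base_subset_of_eq that by metis
qed

lemma inj_on_spans_base:
  assumes "src.base B"
  shows "inj_on f (src.spans (Suc k) B)"
proof -
  obtain B' where B': "tgt.base B'" "f ` src.spans (Suc k) B = tgt.spans (Suc k) B'"
    using image_spans_base[OF assms] .
  have "card (f ` src.spans (Suc k) B) = card (src.spans (Suc k) B)"
    using B'(2) src.base_card[OF assms] tgt.base_card[OF B'(1)]
    by (simp add: card_image src.inj_on_span_nsets[OF src.baseD(1)[OF assms]]
        tgt.inj_on_span_nsets[OF tgt.baseD(1)[OF B'(1)]])
  moreover have "finite (src.spans (Suc k) B)"
    using finite_imp_finite_nsets[OF src.baseD(4)[OF assms]] by blast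
  ultimately show ?thesis by (intro eq_card_imp_inj_on)
qed

definition represents :: "('a set \<Rightarrow> 'b set) \<Rightarrow> 'a set \<Rightarrow> 'b set \<Rightarrow> bool" where
  "represents \<sigma> B B' \<longleftrightarrow> tgt.base B' \<and> bij_betw \<sigma> ([B]\<^bsup>Suc k\<^esup>) ([B']\<^bsup>Suc k\<^esup>) \<and>
     (\<forall>X\<in>[B]\<^bsup>Suc k\<^esup>. f (src.cl X) = tgt.cl (\<sigma> X))"

lemma representsD:
  assumes "represents \<sigma> B B'"
  shows "tgt.base B'" "bij_betw \<sigma> ([B]\<^bsup>Suc k\<^esup>) ([B']\<^bsup>Suc k\<^esup>)"
    "\<And>X. X \<in> [B]\<^bsup>Suc k\<^esup> \<Longrightarrow> f (src.cl X) = tgt.cl (\<sigma> X)"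
  using assms unfolding represents_def by simp_all

lemma represents_exists:
  assumes B: "src.base B"
  obtains \<sigma> B' where "represents \<sigma> B B'"
proof -
  obtain B' where B': "tgt.base B'" "f ` src.spans (Suc k) B = tgt.spans (Suc k) B'"
    using image_spans_base[OF B] .
  let ?\<sigma> = "inv_into ([B']\<^bsup>Suc k\<^esup>) tgt.cl \<circ> (f \<circ> src.cl)"
  have "bij_betw (f \<circ> src.cl) ([B]\<^bsup>Suc k\<^esup>) (tgt.spans (Suc k) B')"
    using inj_on_imp_bij_betw[OF src.inj_on_span_nsets[OF src.baseD(1)[OF B]]]
      inj_on_imp_bij_betw[OF inj_on_spans_base[OF B]] unfolding B'(2) by (rule bij_betw_trans)
  moreover have "bij_betw (inv_into ([B']\<^bsup>Suc k\<^esup>) tgt.cl) (tgt.spans (Suc k) B') ([B']\<^bsup>Suc k\<^esup>)"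
    using inj_on_imp_bij_betw[OF tgt.inj_on_span_nsets[OF tgt.baseD(1)[OF B'(1)]]]
    by (rule bij_betw_inv_into)
  ultimately have "bij_betw ?\<sigma> ([B]\<^bsup>Suc k\<^esup>) ([B']\<^bsup>Suc k\<^esup>)" by (rule bij_betw_trans)
  moreover have "f (src.cl X) = tgt.cl (?\<sigma> X)" if "X \<in> [B]\<^bsup>Suc k\<^esup>" for X
    unfolding comp_def using that B'(2) by (intro f_inv_into_f[symmetric]) blast
  ultimately have "represents ?\<sigma> B B'" unfolding represents_def using B'(1) by blast
  then show ?thesis by (rule that)
qed

lemma span_eq_if_image_eq_edge_point:
  assumes p: "src.edge_point B i j p" and X: "X \<in> [B]\<^bsup>Suc k\<^esup>"
    and S: "S \<in> [insert p (B - {i})]\<^bsup>Suc k\<^esup>" "S \<in> [insert p (B - {j})]\<^bsup>Suc k\<^esup>"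
    and same_image: "f (src.cl X) = f (src.cl S)"
  shows "src.cl X = src.cl S"
proof (cases "X \<in> separating B (Suc k) i j")
  case True
  then have "X \<in> [insert p (B - {j})]\<^bsup>Suc k\<^esup>" unfolding separating_def nsets_def by blast
  moreover have "src.base (insert p (B - {j}))"
    using p src.edge_point_commute src.base_replace_edge_point by blast
  ultimately show ?thesis using inj_onD[OF inj_on_spans_base same_image] S(2) by blast
next
  case False
  then have "src.cl X \<in> src.spans (Suc k) (insert p (B - {i}))"
    by (rule src.span_nset_replace_edge_point[OF p X])
  moreover have "src.base (insert p (B - {i}))" using p by (rule src.base_replace_edge_point)
  ultimately show ?thesis using inj_onD[OF inj_on_spans_base same_image] S(1) by blast
qed

lemma image_spans_replace_neq:
  assumes p: "src.edge_point B i j p"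
  shows "f ` src.spans (Suc k) B \<noteq> f ` src.spans (Suc k) (insert p (B - {i}))"
proof
  let ?C = "insert p (B - {i})" and ?D = "insert p (B - {j})"
  assume same_image: "f ` src.spans (Suc k) B = f ` src.spans (Suc k) ?C"
  note ij = src.edge_pointD[OF p]
  have "k \<le> card (B - {i, j})"
    using src.base_card[OF ij(1)] ij(2-4) k_bounds(2) by (simp add: card_Diff_subset)
  then obtain Y where Y: "Y \<in> [B - {i, j}]\<^bsup>k\<^esup>"
    using nset_between[of "B - {i, j}" "{}" "{}" k] src.baseD(4)[OF ij(1)] by auto
  let ?S = "insert p Y"
  have "p \<notin> B - {i}" using src.edge_point_notin_span_Diff[OF p] span_base by metis
  then have "p \<notin> Y" using Y unfolding nsets_def by blast
  then have S: "?S \<in> [?C]\<^bsup>Suc k\<^esup>" "?S \<in> [?D]\<^bsup>Suc k\<^esup>"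
    using Y unfolding nsets_def by auto
  have "f (src.cl ?S) \<in> f ` src.spans (Suc k) B" unfolding same_image using S(1) by (intro imageI)
  then obtain X where X: "X \<in> [B]\<^bsup>Suc k\<^esup>" "f (src.cl X) = f (src.cl ?S)" by auto
  have same_span: "src.cl X = src.cl ?S" by (rule span_eq_if_image_eq_edge_point[OF p X(1) S X(2)])
  then have "X \<subseteq> B" "p \<in> src.cl X" using X(1) by (simp_all add: nsets_def span_base)
  then have "j \<in> X" using p src.edge_point_commute src.mem_if_edge_point_in_span by blast
  then have "j \<in> src.cl ?S" using same_span span_base by metis
  moreover have "src.indep ?C" using src.base_replace_edge_point[OF p] by (rule src.baseD)
  ultimately have "j \<in> ?S"
    using src.indep_span_mem_iff[of ?C ?S j] S(1) ij(3,4) unfolding nsets_def by simp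
  then show False using ij(6) Y unfolding nsets_def by blast
qed

text \<open>Replacing \<open>i\<close> by a third point of the line \<open>ij\<close> gives a base that still spans every element
  not separating \<open>i\<close> from \<open>j\<close>. So \<open>f\<close> maps these elements into two distinct base
  subsets, hence none of the images separates a certain \<open>i'\<close> from a certain \<open>j'\<close>; counting turns
  this inclusion into an equality.\<close>

lemma separating_subset_image_separating:
  assumes B: "src.base B" and \<sigma>: "represents \<sigma> B B'" and ij: "i \<in> B" "j \<in> B" "i \<noteq> j"
  obtains i' j' where "i' \<in> B'" "j' \<in> B'" "i' \<noteq> j'"
    "separating B' (Suc k) i' j' \<subseteq> \<sigma> ` separating B (Suc k) i j"
proof -
  note \<sigma>D = representsD[OF \<sigma>]
  obtain p where p: "src.edge_point B i j p"
    using third_point ij B src.baseD(3)[OF B] unfolding src.edge_point_def by blast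
  let ?C = "insert p (B - {i})"
  have "src.base ?C" using p by (rule src.base_replace_edge_point)
  then obtain C' where C': "tgt.base C'" "f ` src.spans (Suc k) ?C = tgt.spans (Suc k) C'"
    using image_spans_base by blast
  have "f ` src.spans (Suc k) B = tgt.cl ` \<sigma> ` [B]\<^bsup>Suc k\<^esup>"
    using \<sigma>D(3) by (simp add: image_image)
  then have "B' \<noteq> C'"
    using image_spans_replace_neq[OF p] C'(2) bij_betw_imp_surj_on[OF \<sigma>D(2)] by auto
  then obtain i' where i': "i' \<in> B'" "i' \<notin> C'" using tgt.base_eqI[OF \<sigma>D(1) C'(1)] by blast
  obtain j' where j': "j' \<in> B'" "j' \<noteq> i'"
    "\<forall>X Y. X \<subseteq> B' \<longrightarrow> Y \<subseteq> C' \<longrightarrow> tgt.cl X = tgt.cl Y \<longrightarrow> i' \<in> X \<longrightarrow> j' \<in> X"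
    using tgt.common_span_implied_point[OF \<sigma>D(1) C'(1) i'] .
  have "separating B' (Suc k) i' j' \<subseteq> \<sigma> ` separating B (Suc k) i j"
  proof
    fix Y assume Y: "Y \<in> separating B' (Suc k) i' j'"
    then obtain X where X: "X \<in> [B]\<^bsup>Suc k\<^esup>" "Y = \<sigma> X"
      using bij_betw_imp_surj_on[OF \<sigma>D(2)] unfolding separating_def by blast
    have "X \<in> separating B (Suc k) i j"
    proof (rule ccontr)
      assume "X \<notin> separating B (Suc k) i j"
      then have "src.cl X \<in> src.spans (Suc k) ?C"
        by (rule src.span_nset_replace_edge_point[OF p X(1)])
      then have "f (src.cl X) \<in> tgt.spans (Suc k) C'" unfolding C'(2)[symmetric] by (rule imageI)
      then have "tgt.cl Y \<in> tgt.spans (Suc k) C'" using \<sigma>D(3) X by simp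
      then show False using j'(3) Y unfolding separating_def nsets_def by blast
    qed
    then show "Y \<in> \<sigma> ` separating B (Suc k) i j" using X(2) by blast
  qed
  then show ?thesis by (rule that[OF i'(1) j'(1) j'(2)[symmetric]])
qed

lemma image_separating_eq_separating:
  assumes B: "src.base B" and \<sigma>: "represents \<sigma> B B'" and ij: "i \<in> B" "j \<in> B" "i \<noteq> j"
  shows "\<exists>i' j'. i' \<in> B' \<and> j' \<in> B' \<and> i' \<noteq> j' \<and>
    \<sigma> ` separating B (Suc k) i j = separating B' (Suc k) i' j'"
proof -
  obtain i' j' where ij': "i' \<in> B'" "j' \<in> B'" "i' \<noteq> j'"
    and sub: "separating B' (Suc k) i' j' \<subseteq> \<sigma> ` separating B (Suc k) i j"
    by (rule separating_subset_image_separating[OF assms])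
  note \<sigma>D = representsD[OF \<sigma>]
  have "card (\<sigma> ` separating B (Suc k) i j) = card (separating B (Suc k) i j)"
    using inj_on_subset[OF bij_betw_imp_inj_on[OF \<sigma>D(2)] separating_subset_nsets]
    by (rule card_image)
  also have "\<dots> = card (separating B' (Suc k) i' j')"
    using src.baseD(4)[OF B] tgt.baseD(4)[OF \<sigma>D(1)] src.base_card[OF B] tgt.base_card[OF \<sigma>D(1)]
      ij ij' by (simp add: card_separating)
  finally have "card (\<sigma> ` separating B (Suc k) i j) \<le> card (separating B' (Suc k) i' j')" by simp
  moreover have "finite (\<sigma> ` separating B (Suc k) i j)"
    using finite_subset[OF separating_subset_nsets finite_imp_finite_nsets[OF src.baseD(4)[OF B]]]
    by (rule finite_imageI)
  ultimately have "separating B' (Suc k) i' j' = \<sigma> ` separating B (Suc k) i j"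
    using sub by (intro card_seteq)
  then show ?thesis using ij' by metis
qed

lemma induces_or_coinduces:
  assumes B: "src.base B"
  shows "(\<exists>\<tau>. induces \<tau> B) \<or> n = 2 * k + 1 \<and> (\<exists>\<tau>. coinduces \<tau> B)"
proof -
  obtain \<sigma> B' where \<sigma>: "represents \<sigma> B B'" by (rule represents_exists[OF B])
  note \<sigma>D = representsD[OF \<sigma>]
  obtain s t where st: "\<And>i j. \<lbrakk>i \<in> B; j \<in> B; i \<noteq> j\<rbrakk> \<Longrightarrow> s i j \<in> B' \<and> t i j \<in> B' \<and> s i j \<noteq> t i j \<and>
      \<sigma> ` separating B (Suc k) i j = separating B' (Suc k) (s i j) (t i j)"
    using image_separating_eq_separating[OF B \<sigma>] by metis
  interpret separating_bijection B B' "Suc k" \<sigma> s t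
    using src.baseD(4)[OF B] tgt.baseD(4)[OF \<sigma>D(1)] src.base_card[OF B] tgt.base_card[OF \<sigma>D(1)]
      k_bounds \<sigma>D(2) st by unfold_locales simp_all
  consider \<tau> where "bij_betw \<tau> B B'" "\<forall>X\<in>[B]\<^bsup>Suc k\<^esup>. \<sigma> X = \<tau> ` X"
    | \<tau> where "bij_betw \<tau> B B'" "card B = 2 * Suc k" "\<forall>X\<in>[B]\<^bsup>Suc k\<^esup>. \<sigma> X = B' - \<tau> ` X"
    by (rule image_or_complement)
  then show ?thesis
  proof cases
    case 1
    then have "induces \<tau> B" unfolding induces_def bij_betw_def using \<sigma>D(1,3) by simp
    then show ?thesis by blast
  next
    case 2
    have "f (src.cl X) = tgt.cl (\<tau> ` (B - X))" if X: "X \<in> [B]\<^bsup>Suc k\<^esup>" for X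
    proof -
      have "\<tau> ` (B - X) = B' - \<tau> ` X"
        using 2(1) inj_on_image_set_diff[of \<tau> B B X] X unfolding bij_betw_def nsets_def by simp
      then show ?thesis using \<sigma>D(3) 2(3) X by simp
    qed
    then have "coinduces \<tau> B"
      using 2(1) \<sigma>D(1) unfolding coinduces_def bij_betw_def by simp
    moreover have "n = 2 * k + 1" using 2(2) src.base_card[OF B] by simp
    ultimately show ?thesis by blast
  qed
qed

end

theorem theorem2p2:
  fixes P :: "'a set" and L :: "'a set set" and P' :: "'b set" and L' :: "'b set set"
    and n k :: nat and f :: "'a set \<Rightarrow> 'b set"
  assumes "proj_space_dim P L n" and "proj_space_dim P' L' n"
    and "0 < k" and "k < n - 1"
    and "\<forall>S\<in>Gr P L k. f S \<in> Gr P' L' k"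
    and "\<forall>\<B>. is_base_subset P L k \<B> \<longrightarrow> is_base_subset P' L' k (f ` \<B>)"
  shows "(n \<noteq> 2 * k + 1 \<longrightarrow>
            (\<exists>g. strong_embedding P L P' L' g \<and> (\<forall>S\<in>Gr P L k. f S = span P' L' (g ` S))))
       \<and> (n = 2 * k + 1 \<longrightarrow>
            (\<exists>g. strong_embedding P L P' L' g \<and> (\<forall>S\<in>Gr P L k. f S = span P' L' (g ` S)))
          \<or> (\<exists>g. strong_embedding P L (dual_points P' L' n) (dual_lines P' L' n) g \<and>
               (\<forall>S\<in>Gr P L k. span (dual_points P' L' n) (dual_lines P' L' n) (g ` S)
                              = {H \<in> dual_points P' L' n. f S \<subseteq> H})))"
proof -
  interpret src: projective_geometry_of_dim P L n using assms(1,4) by unfold_locales auto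
  interpret tgt: projective_geometry_of_dim P' L' n using assms(2,4) by unfold_locales auto
  interpret exchange_projective_pair P L P' L' n k f using assms(3,4) by unfold_locales auto
  interpret base_subset_map P L P' L' n k f
    using src.line_third_point assms(6) by unfold_locales (blast, blast)
  show ?thesis
  proof (cases "\<forall>B. src.base B \<longrightarrow> (\<exists>\<tau>. induces \<tau> B)")
    case True
    then show ?thesis using strong_embedding_if_induces by blast
  next
    case False
    then have "n = 2 * k + 1" using induces_or_coinduces by blast
    moreover have "\<forall>B. src.base B \<longrightarrow> (\<exists>\<tau>. coinduces \<tau> B)"
      using induces_all_or_coinduces_all induces_or_coinduces False by blast
    ultimately show ?thesis
      using dual_strong_embedding_if_coinduces unfolding tgt.star_def by blast
  qed
qed

end
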